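(* Let $\mathfrak{c}$ be a given cardinal and let $\mathrm{Bernstein}(1 + \mathfrak{c})$ be the set of types of isomorphism of all Bernstein algebras of dimension $1 + \mathfrak{c}$. Then the map $$\xi : \coprod_{(N, \cdot) \in \mathrm{Types}(4, \mathfrak{c})} \mathcal{BO}(N, \cdot)/\!\approx \ \longrightarrow\ \mathrm{Bernstein}(1 + \mathfrak{c}), \qquad \xi\bigl(\overline{\Omega}\bigr) := N \ltimes_{(\cdot,\,\Omega)} k$$ is bijective, where the coproduct (disjoint union) on the left-hand side is taken over all $4$-algebras $(N, \cdot) \in \mathrm{Types}(4, \mathfrak{c})$ and, for $\Omega \in \mathcal{BO}(N, \cdot)$, $\overline{\Omega}$ denotes the equivalence class of $\Omega$ with respect to the equivalence relation $\approx$ on $\mathcal{BO}(N, \cdot)$.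
   Context: Throughout, $k$ is an infinite field of characteristic $\neq 2$; all vector spaces and (bi)linear maps are over $k$ (vector spaces may be infinite dimensional). An algebra is a vector space $A$ with a bilinear multiplication $A \times A \to A$ (no associativity or unit assumed); $a^2$ denotes the product of $a$ with itself. A baric algebra is a pair $(A, \omega)$ consisting of a commutative algebra $A$ and a non-zero algebra morphism $\omega : A \to k$, called the weight. A Bernstein algebra is a baric algebra $(A, \omega)$ such that $(a^2)^2 = \omega(a)^2\, a^2$ for all $a \in A$. A morphism of Bernstein algebras $(A, \omega_A) \to (B, \omega_B)$ is an algebra map $\psi : A \to B$ with $\omega_B \circ \psi = \omega_A$; an isomorphism is a bijective morphism. A $4$-algebra is a commutative algebra $(N, \cdot)$ such that $(x^2)^2 = 0$ for all $x \in N$. $\mathrm{Types}(4, \mathfrak{c})$ denotes the set of types of isomorphism (as algebras) of $4$-algebras of dimension $\mathfrak{c}$ (possibly infinite); in the coproduct one representative $(N, \cdot)$ is fixed for each isomorphism type. A Bernstein operator on a $4$-algebra $(N, \cdot)$ is an idempotent $\Omega = \Omega^2 \in \mathrm{End}_k(N)$ such that $x^2 \cdot \Omega(x) = 0$ and $\Omega(x)^2 + \Omega(x^2) = x^2$ for all $x \in N$ (here $\Omega(x)^2 = \Omega(x) \cdot \Omega(x)$). $\mathcal{BO}(N, \cdot)$ denotes the set of all Bernstein operators on $(N, \cdot)$, and $\mathrm{Aut}_{\mathrm{Alg}}(N, \cdot)$ denotes the automorphism group of the algebra $(N, \cdot)$. Two Bernstein operators $\Omega, \Omega' \in \mathcal{BO}(N,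 \cdot)$ are called equivalent, denoted $\Omega \approx \Omega'$, if there exists a pair $(v_0, f) \in N \times \mathrm{Aut}_{\mathrm{Alg}}(N, \cdot)$ such that $$\Omega'(x) = (f \circ \Omega \circ f^{-1})(x) - 2\, x \cdot v_0 \ \text{ for all } x \in N, \qquad \Omega'(v_0) = v_0 - v_0^2.$$ This is an equivalence relation on $\mathcal{BO}(N, \cdot)$, with quotient set $\mathcal{BO}(N, \cdot)/\!\approx$. For a $4$-algebra $(N, \cdot)$ and $\Omega \in \mathcal{BO}(N, \cdot)$, the semidirect product $N \ltimes_{(\cdot,\,\Omega)} k$ is the Bernstein algebra with underlying vector space $N \times k$, multiplication $$(x, \alpha) \circ (y, \beta) := \bigl(x \cdot y + \tfrac{1}{2}\alpha\, \Omega(y) + \tfrac{1}{2}\beta\, \Omega(x),\ \alpha\beta\bigr)$$ and weight $\pi_2(x, \alpha) = \alpha$. In the definition of $\xi$, $N \ltimes_{(\cdot,\,\Omega)} k$ stands for its isomorphism type as a Bernstein algebra. *)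

theory Defs
  imports "Jordan_Normal_Form.Missing_VectorSpace"
begin

unbundle cardinal_syntax

text \<open>An algebra is a record of type \<^typ>\<open>('k, 'v) module\<close>, a type that already has a field
  \<open>mult\<close>. Its field \<open>one\<close> carries no information: no property of algebras and no notion of
  morphism below refers to it.\<close>

locale nonassoc_algebra = vectorspace K A for K and A (structure) +
  assumes mult_linear_right: "x \<in> carrier A \<Longrightarrow> (\<lambda>y. x \<otimes> y) \<in> module_hom K A A"
    and mult_linear_left: "y \<in> carrier A \<Longrightarrow> (\<lambda>x. x \<otimes> y) \<in> module_hom K A A"

locale comm_nonassoc_algebra = nonassoc_algebra +
  assumes mult_commutative: "x \<in> carrier A \<Longrightarrow> y \<in> carrier A \<Longrightarrow> x \<otimes> y = y \<otimes> x"

locale four_algebra = comm_nonassoc_algebra +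
  assumes square_square_zero: "x \<in> carrier A \<Longrightarrow> (x \<otimes> x) \<otimes> (x \<otimes> x) = \<zero>"

definition algebra_hom ::
  "('k, 'm) ring_scheme \<Rightarrow> ('k, 'a, 'r) module_scheme \<Rightarrow> ('k, 'b, 's) module_scheme
    \<Rightarrow> ('a \<Rightarrow> 'b) set"
where
  "algebra_hom K A B = {f \<in> module_hom K A B.
     \<forall>x\<in>carrier A. \<forall>y\<in>carrier A. f (x \<otimes>\<^bsub>A\<^esub> y) = f x \<otimes>\<^bsub>B\<^esub> f y}"

definition algebra_iso ::
  "('k, 'm) ring_scheme \<Rightarrow> ('k, 'a, 'r) module_scheme \<Rightarrow> ('k, 'b, 's) module_scheme
    \<Rightarrow> ('a \<Rightarrow> 'b) set"
where
  "algebra_iso K A B = {f \<in> algebra_hom K A B. bij_betw f (carrier A) (carrier B)}"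

definition scalar_algebra :: "('k, 'm) ring_scheme \<Rightarrow> ('k, 'k) module" where
  "scalar_algebra K = \<lparr>carrier = carrier K, mult = mult K, one = one K, zero = zero K,
     add = add K, smult = mult K\<rparr>"

locale baric_algebra = comm_nonassoc_algebra +
  fixes \<omega>
  assumes weight_hom: "\<omega> \<in> algebra_hom K A (scalar_algebra K)"
    and weight_nonzero: "\<exists>x\<in>carrier A. \<omega> x \<noteq> \<zero>\<^bsub>K\<^esub>"

locale bernstein_algebra = baric_algebra +
  assumes bernstein_identity:
    "a \<in> carrier A \<Longrightarrow> (a \<otimes> a) \<otimes> (a \<otimes> a) = (\<omega> a \<otimes>\<^bsub>K\<^esub> \<omega> a) \<odot> (a \<otimes> a)"

definition bernstein_iso ::
  "('k, 'm) ring_scheme \<Rightarrow> ('k, 'a) module \<times> ('a \<Rightarrow> 'k) \<Rightarrow> ('k, 'b) module \<times> ('b \<Rightarrow> 'k)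
    \<Rightarrow> ('a \<Rightarrow> 'b) set"
where
  "bernstein_iso K = (\<lambda>(A, \<omega>\<^sub>A) (B, \<omega>\<^sub>B).
     {\<psi> \<in> algebra_iso K A B. \<forall>x\<in>carrier A. \<omega>\<^sub>B (\<psi> x) = \<omega>\<^sub>A x})"

definition has_dimension :: "('k, 'm) ring_scheme \<Rightarrow> ('k, 'a) module \<Rightarrow> 'c rel \<Rightarrow> bool" where
  "has_dimension K A c \<longleftrightarrow> (\<exists>B. vectorspace.basis K A B \<and> |B| =o c)"

text \<open>The type variable \<open>'u\<close> plays the role of the universe: the algebras that are classified are
  those whose carrier is a set of elements of \<open>'u\<close>. It should be chosen large enough to
  accommodate the field and the dimension in question, for instance \<open>'c option \<Rightarrow> 'k\<close>. The isomorphism type of an algebra is the set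
  of all algebras in the universe isomorphic to it; the algebra itself may live on another type, as
  a semidirect product over \<open>'u\<close> does.\<close>

definition four_algebras :: "('k, 'm) ring_scheme \<Rightarrow> 'c rel \<Rightarrow> ('k, 'u) module set" where
  "four_algebras K c = {N. four_algebra K N \<and> has_dimension K N c}"

definition four_algebra_type ::
  "('k, 'm) ring_scheme \<Rightarrow> 'c rel \<Rightarrow> ('k, 'a) module \<Rightarrow> ('k, 'u) module set"
where
  "four_algebra_type K c N = {N' \<in> four_algebras K c. algebra_iso K N N' \<noteq> {}}"

definition four_algebra_types ::
  "('k, 'm) ring_scheme \<Rightarrow> 'c rel \<Rightarrow> ('k, 'u) module set set"
where
  "four_algebra_types K c =
     four_algebra_type K c ` (four_algebras K c :: ('k, 'u) module set)"

definition bernstein_algebras ::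
  "('k, 'm) ring_scheme \<Rightarrow> 'c rel \<Rightarrow> (('k, 'u) module \<times> ('u \<Rightarrow> 'k)) set"
where
  "bernstein_algebras K c = {(A, \<omega>). bernstein_algebra K A \<omega> \<and> has_dimension K A c}"

definition bernstein_type ::
  "('k, 'm) ring_scheme \<Rightarrow> 'c rel \<Rightarrow> ('k, 'a) module \<times> ('a \<Rightarrow> 'k)
    \<Rightarrow> (('k, 'u) module \<times> ('u \<Rightarrow> 'k)) set"
where
  "bernstein_type K c A = {B \<in> bernstein_algebras K c. bernstein_iso K A B \<noteq> {}}"

definition bernstein_types ::
  "('k, 'm) ring_scheme \<Rightarrow> 'c rel \<Rightarrow> (('k, 'u) module \<times> ('u \<Rightarrow> 'k)) set set"
where
  "bernstein_types K c =
     bernstein_type K c ` (bernstein_algebras K c :: (('k, 'u) module \<times> ('u \<Rightarrow> 'k)) set)"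

text \<open>Operators are required to be \<^const>\<open>extensional\<close>, so that two of them are equal iff they
  agree on the carrier.\<close>

definition bernstein_operators ::
  "('k, 'm) ring_scheme \<Rightarrow> ('k, 'a) module \<Rightarrow> ('a \<Rightarrow> 'a) set"
where
  "bernstein_operators K N = {\<Omega> \<in> module_hom K N N \<inter> extensional (carrier N).
     \<forall>x\<in>carrier N. \<Omega> (\<Omega> x) = \<Omega> x \<and>
       (x \<otimes>\<^bsub>N\<^esub> x) \<otimes>\<^bsub>N\<^esub> \<Omega> x = \<zero>\<^bsub>N\<^esub> \<and>
       (\<Omega> x \<otimes>\<^bsub>N\<^esub> \<Omega> x) \<oplus>\<^bsub>N\<^esub> \<Omega> (x \<otimes>\<^bsub>N\<^esub> x) = x \<otimes>\<^bsub>N\<^esub> x}"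

definition two :: "('k, 'm) ring_scheme \<Rightarrow> 'k" where
  "two K = \<one>\<^bsub>K\<^esub> \<oplus>\<^bsub>K\<^esub> \<one>\<^bsub>K\<^esub>"

definition bernstein_operator_equiv ::
  "('k, 'm) ring_scheme \<Rightarrow> ('k, 'a) module \<Rightarrow> ('a \<Rightarrow> 'a) rel"
where
  "bernstein_operator_equiv K N = {(\<Omega>, \<Omega>').
     \<Omega> \<in> bernstein_operators K N \<and> \<Omega>' \<in> bernstein_operators K N \<and>
     (\<exists>v\<^sub>0\<in>carrier N. \<exists>f\<in>algebra_iso K N N.
        (\<forall>x\<in>carrier N.
           \<Omega>' x = f (\<Omega> (inv_into (carrier N) f x)) \<ominus>\<^bsub>N\<^esub> two K \<odot>\<^bsub>N\<^esub> (x \<otimes>\<^bsub>N\<^esub> v\<^sub>0)) \<and>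
        \<Omega>' v\<^sub>0 = v\<^sub>0 \<ominus>\<^bsub>N\<^esub> (v\<^sub>0 \<otimes>\<^bsub>N\<^esub> v\<^sub>0))}"

text \<open>The multiplication put in place by \<^const>\<open>direct_sum\<close> is the zero one; it is replaced.\<close>

definition semidirect_product ::
  "('k, 'm) ring_scheme \<Rightarrow> ('k, 'a) module \<Rightarrow> ('a \<Rightarrow> 'a)
    \<Rightarrow> ('k, 'a \<times> 'k) module \<times> ('a \<times> 'k \<Rightarrow> 'k)"
where
  "semidirect_product K N \<Omega> =
     ((direct_sum N (scalar_algebra K))
        \<lparr>mult := \<lambda>(x, \<alpha>) (y, \<beta>).
           ((x \<otimes>\<^bsub>N\<^esub> y) \<oplus>\<^bsub>N\<^esub> (inv\<^bsub>K\<^esub> (two K) \<otimes>\<^bsub>K\<^esub> \<alpha>) \<odot>\<^bsub>N\<^esub> \<Omega> y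
              \<oplus>\<^bsub>N\<^esub> (inv\<^bsub>K\<^esub> (two K) \<otimes>\<^bsub>K\<^esub> \<beta>) \<odot>\<^bsub>N\<^esub> \<Omega> x,
            \<alpha> \<otimes>\<^bsub>K\<^esub> \<beta>)\<rparr>,
      snd)"

text \<open>Below, \<open>rep\<close> is the choice of one representative in each isomorphism type.\<close>

definition operator_class_coproduct ::
  "('k, 'm) ring_scheme \<Rightarrow> 'c rel \<Rightarrow> (('k, 'u) module set \<Rightarrow> ('k, 'u) module)
    \<Rightarrow> (('k, 'u) module set \<times> ('u \<Rightarrow> 'u) set) set"
where
  "operator_class_coproduct K c rep =
     (SIGMA T:four_algebra_types K c.
        bernstein_operators K (rep T) // bernstein_operator_equiv K (rep T))"

text \<open>The union over an equivalence class is the usual way to lift a function to a quotient: it is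
  the common value if the function is constant on the class.\<close>

definition xi ::
  "('k, 'm) ring_scheme \<Rightarrow> 'c rel \<Rightarrow> (('k, 'u) module set \<Rightarrow> ('k, 'u) module)
    \<Rightarrow> ('k, 'u) module set \<times> ('u \<Rightarrow> 'u) set \<Rightarrow> (('k, 'u) module \<times> ('u \<Rightarrow> 'k)) set"
where
  "xi K c rep = (\<lambda>(T, C).
     \<Union>\<Omega>\<in>C. bernstein_type K (cone +c c) (semidirect_product K (rep T) \<Omega>))"

end

theory Submission
  imports Defs
begin

text \<open>A Bernstein algebra \<open>(A, \<omega>)\<close> is governed by an idempotent. If \<open>\<omega> a = 1\<close>, the Bernstein
  identity says that \<open>e = a\<^sup>2\<close> is idempotent, and \<open>\<omega> e = 1\<close>; so \<open>A\<close> is the direct sum of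
  \<open>N = ker \<omega>\<close> and \<open>k e\<close>. The identity restricted to \<open>N\<close> says that \<open>N\<close> is a 4-algebra, and the
  product of \<open>A\<close> is determined by that of \<open>N\<close> together with the operator \<open>\<Omega> x = 2 e x\<close> on \<open>N\<close>.
  Evaluating the identity at \<open>e + t x\<close> for \<open>x \<in> N\<close> and comparing the coefficients of \<open>t\<close>,
  \<open>t\<^sup>2\<close>, \<open>t\<^sup>3\<close> (the field is infinite) gives exactly the three axioms of a Bernstein operator
  (\<open>peirce_identities\<close>). Conversely those axioms make every semidirect product a Bernstein algebra
  (\<open>semidirect_bernstein\<close>), and \<open>(x, \<alpha>) \<mapsto> x + \<alpha> e\<close> identifies the semidirect product of \<open>N\<close> by
  \<open>2 e x\<close> with \<open>A\<close> (\<open>semidirect_iso\<close>). This yields surjectivity of the map \<open>\<xi>\<close>.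

  The 4-algebra \<open>N\<close> is intrinsic, being the kernel of the weight, while \<open>e\<close> is a choice. An
  isomorphism of semidirect products over \<open>N\<close> restricts to an automorphism \<open>f\<close> of \<open>N\<close> on the
  kernels and sends the idempotent \<open>(0, 1)\<close> to an idempotent of weight 1, hence of the form
  \<open>(v, 1)\<close>. Idempotency of \<open>(v, 1)\<close> reads \<open>\<Omega>' v = v - v\<^sup>2\<close>, and multiplicativity on the products
  \<open>(x, 0)(0, 1)\<close> says that \<open>\<Omega>'\<close> is \<open>x \<mapsto> f (\<Omega> (f\<^sup>-\<^sup>1 x)) - 2 x v\<close>: the pair \<open>(v, f)\<close> is a
  witness of \<open>\<Omega> \<approx> \<Omega>'\<close>, and every witness arises in this way. So \<open>\<Omega> \<approx> \<Omega>'\<close> means that the semidirect products are isomorphic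
  (\<open>bernstein_operator_equiv_iff\<close>). That \<open>\<approx>\<close> is an equivalence relation, that \<open>\<xi>\<close> is well defined
  and that it is injective all follow from this.

  Two matters of size remain. The dimension of \<open>A\<close> is \<open>1 + c\<close> exactly when that of \<open>ker \<omega>\<close> is \<open>c\<close>
  (\<open>has_dimension_hyperplane\<close>, \<open>has_dimension_from_hyperplane\<close>); the argument produces a basis of
  the required size and never compares two bases of one space. And an isomorphism type is
  a set of algebras in the universe \<open>'u\<close>, so two algebras outside it could share the empty type;
  a semidirect product over an algebra in \<open>'u\<close> has a copy there because an infinite \<open>'u\<close> that
  contains \<open>N\<close> and \<open>k\<close> has room for \<open>N \<times> k\<close> (\<open>semidirect_in_universe\<close>).\<close>

section \<open>Linear maps and bases\<close>

lemma linear_mapI: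
  assumes "vectorspace K V" "vectorspace K W" "f \<in> module_hom K V W"
  shows "linear_map K V W f"
  using assms by (simp add: linear_map_def mod_hom_def mod_hom_axioms_def vectorspace_def)

context linear_map
begin

text \<open>The vectors whose image lies in the span of \<open>T ` S\<close> form a subspace containing \<open>S\<close>.\<close>

lemma span_image_surj:
  assumes S: "S \<subseteq> carrier V" and gen: "V.module.span S = carrier V"
    and surj: "T ` carrier V = carrier W"
  shows "W.module.span (T ` S) = carrier W"
proof
  have TS: "T ` S \<subseteq> carrier W" using S by auto
  then show "W.module.span (T ` S) \<subseteq> carrier W" by (rule W.module.span_is_subset2)
  have sub: "submodule K (W.module.span (T ` S)) W" using TS by (rule W.module.span_is_submodule)
  let ?P = "{v \<in> carrier V. T v \<in> W.module.span (T ` S)}"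
  have "submodule K ?P V"
    using sub by (auto simp: submodule_def V.module.module_axioms)
  moreover have "S \<subseteq> ?P" using S W.module.in_own_span[OF TS] by auto
  ultimately have "V.module.span S \<subseteq> ?P" by (intro V.module.span_is_subset)
  then have "T ` carrier V \<subseteq> W.module.span (T ` S)" using gen by auto
  then show "carrier W \<subseteq> W.module.span (T ` S)" using surj by simp
qed

text \<open>The images satisfy the same linear relations as the vectors themselves.\<close>

lemma lin_indpt_image:
  assumes S: "S \<subseteq> carrier V" and li: "V.module.lin_indpt S" and inj: "inj_on T (carrier V)"
  shows "W.module.lin_indpt (T ` S)"
proof
  assume "W.module.lin_dep (T ` S)"
  then obtain A a w where A: "finite A" "A \<subseteq> T ` S" "a \<in> A \<rightarrow> carrier K"
      "W.module.lincomb a A = \<zero>\<^bsub>W\<^esub>" "w \<in> A" "a w \<noteq> \<zero>\<^bsub>K\<^esub>"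
    unfolding W.module.lin_dep_def by blast
  obtain B where B: "finite B" "B \<subseteq> S" "A = T ` B"
    using finite_subset_image[OF A(1,2)] by blast
  have BV: "B \<subseteq> carrier V" and a: "a \<circ> T \<in> B \<rightarrow> carrier K" using A B S by auto
  have "T (V.module.lincomb (a \<circ> T) B) = T \<zero>\<^bsub>V\<^esub>"
    using lincomb_linear_image[OF inj BV _ B(1), of a] A B by simp
  then have "V.module.lincomb (a \<circ> T) B = \<zero>\<^bsub>V\<^esub>"
    using V.module.lincomb_closed[OF BV a] by (intro inj_onD[OF inj]) auto
  moreover obtain v where "v \<in> B" "w = T v" using A B by blast
  ultimately have "V.module.lin_dep S"
    using A B a by (intro V.module.lin_dep_crit[of B S "a \<circ> T" v]) auto
  then show False using li by blast
qed

end

lemma has_dimension_iso: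
  assumes V: "vectorspace K V" and W: "vectorspace K W" and f: "f \<in> module_hom K V W"
    and bij: "bij_betw f (carrier V) (carrier W)" and dim: "has_dimension K V c"
  shows "has_dimension K W c"
proof -
  interpret linear_map K V W f using V W f by (rule linear_mapI)
  obtain B where B: "V.basis B" "|B| =o c" using dim unfolding has_dimension_def by blast
  have Bc: "B \<subseteq> carrier V" using B by (simp add: V.basis_def)
  have inj: "inj_on f (carrier V)" using bij by (simp add: bij_betw_def)
  have "W.basis (f ` B)"
    unfolding W.basis_def
    using lin_indpt_image[OF Bc _ inj] span_image_surj[OF Bc] B(1) bij Bc
    by (auto simp: V.basis_def bij_betw_def)
  moreover have "|f ` B| =o |B|"
    using inj_on_subset[OF inj Bc] card_of_ordIso ordIso_symmetric by (metis bij_betw_imageI)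
  ultimately show ?thesis unfolding has_dimension_def using B(2) ordIso_transitive by blast
qed

lemma Field_cone: "Field cone = {()}"
  by (simp add: cone_def Field_card_of)

text \<open>Cancellation of one point, valid for finite and infinite cardinals alike. Any bijection \<open>h\<close> onto
  \<open>1 + c\<close> is corrected to send \<open>b\<close> to the extra point by exchanging two values.\<close>

lemma card_of_remove:
  assumes B: "|B| =o cone +c c" and b: "b \<in> B" and c: "Card_order c"
  shows "|B - {b}| =o c"
proof -
  have "cone +c c = |{()} <+> Field c|" by (simp add: csum_def Field_cone)
  then obtain h where h: "bij_betw h B ({()} <+> Field c)"
    using B card_of_ordIso[of B "{()} <+> Field c"] by auto
  define g where "g x = (if h x = Inl () then h b else h x)" for x
  have inj: "inj_on h B" and im: "h ` B = {()} <+> Field c" using h by (auto simp: bij_betw_def)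
  obtain x0 where x0: "x0 \<in> B" "h x0 = Inl ()" using im by (metis InlI imageE insertI1)
  have "inj_on g (B - {b})"
    using inj b by (auto simp: g_def inj_on_def split: if_splits)
  moreover have "g ` (B - {b}) = (Inr ` Field c :: (unit + _) set)"
  proof
    show "g ` (B - {b}) \<subseteq> (Inr ` Field c :: (unit + _) set)"
    proof
      fix y assume "y \<in> g ` (B - {b})"
      then obtain x where x: "x \<in> B" "x \<noteq> b" "y = g x" by auto
      have "y \<in> {()} <+> Field c" "y \<noteq> Inl ()"
        using x b inj im by (auto simp: g_def inj_on_def)
      then show "y \<in> (Inr ` Field c :: (unit + _) set)" by auto
    qed
    show "(Inr ` Field c :: (unit + _) set) \<subseteq> g ` (B - {b})"
    proof
      fix y assume y: "y \<in> (Inr ` Field c :: (unit + _) set)"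
      then have "y \<in> h ` B" using im by auto
      then obtain x where x: "x \<in> B" "y = h x" by auto
      show "y \<in> g ` (B - {b})"
      proof (cases "x = b")
        case True
        then have "x0 \<in> B - {b}" "g x0 = y" using x0 x y by (auto simp: g_def)
        then show ?thesis by blast
      next
        case False
        then have "x \<in> B - {b}" "g x = y" using x y by (auto simp: g_def)
        then show ?thesis by blast
      qed
    qed
  qed
  ultimately have "bij_betw g (B - {b}) (Inr ` Field c :: (unit + _) set)"
    by (auto simp: bij_betw_def)
  then have "|B - {b}| =o |Inr ` Field c :: (unit + _) set|" using card_of_ordIso by blast
  also have "|Inr ` Field c :: (unit + _) set| =o |Field c|"
    using card_of_ordIso by (metis bij_betw_imageI inj_Inr ordIso_symmetric inj_on_subset subset_UNIV)
  also have "|Field c| =o c" using c by (rule card_of_Field_ordIso)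
  finally show ?thesis .
qed

lemma card_of_insert_fresh:
  assumes B: "|B| =o c" and b: "b \<notin> B"
  shows "|insert b B| =o cone +c c"
proof -
  have "|insert b B| =o |{()} <+> B|"
  proof -
    have "bij_betw (case_sum (\<lambda>_. b) id) ({()} <+> B) (insert b B)"
      using b by (auto simp: bij_betw_def inj_on_def image_Un Plus_def image_image)
    then show ?thesis using card_of_ordIso ordIso_symmetric by blast
  qed
  also have "|{()} <+> B| =o cone +c |B|"
    by (simp add: csum_def Field_cone Field_card_of ordIso_refl[OF card_of_Card_order])
  also have "cone +c |B| =o cone +c c" using B by (rule csum_cong2)
  finally show ?thesis .
qed

lemma vectorspace_scalar_algebra:
  assumes "field K"
  shows "vectorspace K (scalar_algebra K)"
proof -
  interpret field K by fact
  show ?thesis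
    by (rule vs_criteria[OF assms])
      (auto simp: scalar_algebra_def a_ac m_ac l_distr r_distr intro: bexI[of _ "\<ominus>\<^bsub>K\<^esub> _"] r_neg)
qed

text \<open>A basis of the kernel of a linear form, together with a vector where the form is 1, is a basis of
  the whole space.\<close>

lemma has_dimension_from_hyperplane:
  assumes V: "vectorspace K V" and w: "\<omega> \<in> module_hom K V (scalar_algebra K)"
    and e: "e \<in> carrier V" "\<omega> e = \<one>\<^bsub>K\<^esub>"
    and dim: "has_dimension K (V\<lparr>carrier := {x \<in> carrier V. \<omega> x = \<zero>\<^bsub>K\<^esub>}\<rparr>) c"
  shows "has_dimension K V (cone +c c)"
proof -
  interpret V: vectorspace K V by fact
  have "field K" using V by (simp add: vectorspace_def)
  then interpret w: linear_map K V "scalar_algebra K" \<omega>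
    using V w vectorspace_scalar_algebra by (intro linear_mapI)
  define N where "N = {x \<in> carrier V. \<omega> x = \<zero>\<^bsub>K\<^esub>}"
  have "N = w.ker" unfolding N_def w.ker_def by (simp add: scalar_algebra_def)
  then have sub: "submodule K N V" and "subspace K N V"
    using w.ker_is_submodule w.kerT_is_subspace by auto
  then interpret N: vectorspace K "V\<lparr>carrier := N\<rparr>" by (intro V.subspace_is_vs)
  obtain B where "N.basis B" and card: "|B| =o c"
    using dim unfolding has_dimension_def N_def by blast
  then have B: "B \<subseteq> N" "V.module.lin_indpt B" "V.module.span B = N"
    using V.module.span_li_not_depend[OF _ sub, of B] by (auto simp: N.basis_def)
  have BV: "B \<subseteq> carrier V" using B by (auto simp: N_def)
  have eB: "e \<notin> N" using e by (simp add: N_def)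
  have li: "V.module.lin_indpt (B \<union> {e})"
    using V.lin_dep_iff_in_span[OF BV B(2) e(1)] B eB by blast
  have Be: "B \<union> {e} \<subseteq> carrier V" using BV e by simp
  have "carrier V \<subseteq> V.module.span (B \<union> {e})"
  proof
    fix x assume x: "x \<in> carrier V"
    then have wx: "\<omega> x \<in> carrier K" using w.f_im[of x] by (simp add: scalar_algebra_def)
    have "x \<ominus>\<^bsub>V\<^esub> \<omega> x \<odot>\<^bsub>V\<^esub> e \<in> N"
      using x wx e unfolding N_def V.module.M.minus_eq
      by (simp add: V.module.smult_l_minus[symmetric])
        (simp add: scalar_algebra_def V.module.R.r_neg)
    then have "x \<ominus>\<^bsub>V\<^esub> \<omega> x \<odot>\<^bsub>V\<^esub> e \<in> V.module.span (B \<union> {e})"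
      using B V.module.span_is_monotone[of B "B \<union> {e}"] by blast
    moreover have "e \<in> V.module.span (B \<union> {e})" using V.module.in_own_span[OF Be] by blast
    ultimately have "(x \<ominus>\<^bsub>V\<^esub> \<omega> x \<odot>\<^bsub>V\<^esub> e) \<oplus>\<^bsub>V\<^esub> \<omega> x \<odot>\<^bsub>V\<^esub> e \<in> V.module.span (B \<union> {e})"
      using V.module.span_is_submodule[OF Be] wx unfolding submodule_def by blast
    moreover have "(x \<ominus>\<^bsub>V\<^esub> \<omega> x \<odot>\<^bsub>V\<^esub> e) \<oplus>\<^bsub>V\<^esub> \<omega> x \<odot>\<^bsub>V\<^esub> e = x"
      using x wx e by (simp add: V.module.M.minus_eq V.module.M.a_assoc V.module.M.l_neg)
    ultimately show "x \<in> V.module.span (B \<union> {e})" by simp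
  qed
  then have "V.basis (insert e B)"
    unfolding V.basis_def using li Be V.module.span_is_subset2[OF Be] by auto
  moreover have "|insert e B| =o cone +c c" using card eB B by (intro card_of_insert_fresh) auto
  ultimately show ?thesis unfolding has_dimension_def by blast
qed

text \<open>Some vector \<open>b\<close> of a given basis \<open>B\<close> has \<open>\<omega> b \<noteq> 0\<close>. The projection \<open>p\<close> onto \<open>ker \<omega>\<close> along \<open>b\<close>
  restricts to an isomorphism from the span of \<open>B - {b}\<close> onto \<open>ker \<omega>\<close>, since both subspaces are
  complements of the line through \<open>b\<close>. So \<open>ker \<omega>\<close> has a basis of the size of \<open>B - {b}\<close>.\<close>

lemma has_dimension_hyperplane:
  assumes V: "vectorspace K V" and w: "\<omega> \<in> module_hom K V (scalar_algebra K)"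
    and e: "e \<in> carrier V" "\<omega> e \<noteq> \<zero>\<^bsub>K\<^esub>"
    and c: "Card_order c" and dim: "has_dimension K V (cone +c c)"
  shows "has_dimension K (V\<lparr>carrier := {x \<in> carrier V. \<omega> x = \<zero>\<^bsub>K\<^esub>}\<rparr>) c"
proof -
  interpret V: vectorspace K V by fact
  have "field K" using V by (simp add: vectorspace_def)
  then interpret w: linear_map K V "scalar_algebra K" \<omega>
    using V w vectorspace_scalar_algebra by (intro linear_mapI)
  note [simp del] = w.f_add w.f_smult
  have w_closed: "\<omega> x \<in> carrier K" if "x \<in> carrier V" for x
    using w.f_im[OF that] by (simp add: scalar_algebra_def)
  have w_add: "\<omega> (x \<oplus>\<^bsub>V\<^esub> y) = \<omega> x \<oplus>\<^bsub>K\<^esub> \<omega> y" if "x \<in> carrier V" "y \<in> carrier V" for x y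
    using w.f_add[OF that] by (simp add: scalar_algebra_def)
  have w_smult: "\<omega> (r \<odot>\<^bsub>V\<^esub> x) = r \<otimes>\<^bsub>K\<^esub> \<omega> x" if "r \<in> carrier K" "x \<in> carrier V" for r x
    using w.f_smult[OF that] by (simp add: scalar_algebra_def)
  define N where "N = {x \<in> carrier V. \<omega> x = \<zero>\<^bsub>K\<^esub>}"
  have "N = w.ker" unfolding N_def w.ker_def by (simp add: scalar_algebra_def)
  then have sub: "submodule K N V" and "subspace K N V"
    using w.ker_is_submodule w.kerT_is_subspace by auto
  then interpret N: vectorspace K "V\<lparr>carrier := N\<rparr>" by (intro V.subspace_is_vs)
  obtain B where B: "V.basis B" and card: "|B| =o cone +c c"
    using dim unfolding has_dimension_def by blast
  have BV: "B \<subseteq> carrier V" and li: "V.module.lin_indpt B" and gen: "V.module.span B = carrier V"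
    using B by (auto simp: V.basis_def)
  have "\<not> B \<subseteq> N"
    using V.module.span_is_subset[OF _ sub] gen e by (auto simp: N_def)
  then obtain b where b: "b \<in> B" "\<omega> b \<noteq> \<zero>\<^bsub>K\<^esub>" using BV by (auto simp: N_def)
  have bV: "b \<in> carrier V" using b BV by auto
  \<comment> \<open>\<open>q x\<close> is the coefficient that makes \<open>\<omega> (x + q x b)\<close> vanish.\<close>
  define q where "q x = \<ominus>\<^bsub>K\<^esub> (\<omega> x \<otimes>\<^bsub>K\<^esub> inv\<^bsub>K\<^esub> \<omega> b)" for x
  define p where "p x = x \<oplus>\<^bsub>V\<^esub> q x \<odot>\<^bsub>V\<^esub> b" for x
  have inv: "inv\<^bsub>K\<^esub> \<omega> b \<in> carrier K" "inv\<^bsub>K\<^esub> \<omega> b \<otimes>\<^bsub>K\<^esub> \<omega> b = \<one>\<^bsub>K\<^esub>"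
    using V.field.field_Units b w_closed[OF bV] by auto
  have q_closed: "q x \<in> carrier K" if "x \<in> carrier V" for x
    using that inv w_closed by (simp add: q_def)
  have q_add: "q (x \<oplus>\<^bsub>V\<^esub> y) = q x \<oplus>\<^bsub>K\<^esub> q y" if "x \<in> carrier V" "y \<in> carrier V" for x y
    using that inv w_closed by (simp add: q_def w_add V.module.R.l_distr V.module.R.minus_add)
  have q_smult: "q (r \<odot>\<^bsub>V\<^esub> x) = r \<otimes>\<^bsub>K\<^esub> q x" if "r \<in> carrier K" "x \<in> carrier V" for r x
    using that inv w_closed by (simp add: q_def w_smult V.module.R.r_minus V.module.R.m_assoc)
  have q_b: "q b = \<ominus>\<^bsub>K\<^esub> \<one>\<^bsub>K\<^esub>"
    using inv w_closed[OF bV] by (simp add: q_def V.module.R.m_comm)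
  have p_closed: "p x \<in> N" if "x \<in> carrier V" for x
    using that bV q_closed w_closed inv
    by (simp add: p_def N_def w_add w_smult)
      (simp add: q_def V.module.R.l_minus V.module.R.m_assoc V.module.R.r_neg)
  have p_add: "p (x \<oplus>\<^bsub>V\<^esub> y) = p x \<oplus>\<^bsub>V\<^esub> p y" if "x \<in> carrier V" "y \<in> carrier V" for x y
    using that bV q_closed by (simp add: p_def q_add V.module.smult_l_distr V.module.M.a_ac)
  have p_smult: "p (r \<odot>\<^bsub>V\<^esub> x) = r \<odot>\<^bsub>V\<^esub> p x" if "r \<in> carrier K" "x \<in> carrier V" for r x
    using that bV q_closed by (simp add: p_def q_smult V.module.smult_r_distr V.module.smult_assoc1)
  have p_b: "p b = \<zero>\<^bsub>V\<^esub>"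
    using bV by (simp add: p_def q_b V.module.smult_l_minus V.module.smult_one V.module.M.r_neg)
  have p_id: "p x = x" if "x \<in> N" for x
    using that bV inv by (simp add: p_def q_def N_def)
  let ?S = "B - {b}"
  have SV: "?S \<subseteq> carrier V" using BV by auto
  have li_S: "V.module.lin_indpt ?S" using li by (rule V.module.subset_li_is_li) auto
  let ?U = "V\<lparr>carrier := V.module.span ?S\<rparr>"
  have sub_S: "submodule K (V.module.span ?S) V" using SV by (rule V.module.span_is_submodule)
  have U: "vectorspace K ?U" using SV by (intro V.subspace_is_vs V.span_is_subspace)
  then interpret U: vectorspace K ?U .
  have span_V: "V.module.span ?S \<subseteq> carrier V" using SV by (rule V.module.span_is_subset2)
  have S_span: "?S \<subseteq> V.module.span ?S" using SV by (rule V.module.in_own_span)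
  have b_span: "b \<notin> V.module.span ?S"
    using V.lin_dep_iff_in_span[OF SV li_S bV] li b by (simp add: insert_absorb)
  have basis_U: "U.basis ?S"
    unfolding U.basis_def using V.module.span_li_not_depend[OF S_span sub_S] li_S S_span by auto
  have hom: "p \<in> module_hom K ?U (V\<lparr>carrier := N\<rparr>)"
    using subsetD[OF span_V] by (auto simp: module_hom_def p_closed p_add p_smult)
  interpret p: linear_map K ?U "V\<lparr>carrier := N\<rparr>" p
    using U N.vectorspace_axioms hom by (rule linear_mapI)
  have ker: "v = \<zero>\<^bsub>V\<^esub>" if v: "v \<in> V.module.span ?S" "p v = \<zero>\<^bsub>V\<^esub>" for v
  proof (rule ccontr)
    assume nz: "v \<noteq> \<zero>\<^bsub>V\<^esub>"
    have vV: "v \<in> carrier V" using v span_V by auto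
    have qv: "q v \<in> carrier K" using vV by (rule q_closed)
    have qnz: "q v \<noteq> \<zero>\<^bsub>K\<^esub>" using v nz vV bV by (auto simp: p_def)
    then have iq: "inv\<^bsub>K\<^esub> q v \<in> carrier K" "inv\<^bsub>K\<^esub> q v \<otimes>\<^bsub>K\<^esub> q v = \<one>\<^bsub>K\<^esub>"
      using V.field.field_Units qv by auto
    \<comment> \<open>A vector killed by \<open>p\<close> is a multiple of \<open>b\<close>; a non-zero one would put \<open>b\<close> into the span.\<close>
    have "\<ominus>\<^bsub>V\<^esub> v = q v \<odot>\<^bsub>V\<^esub> b"
      using v vV bV qv V.module.M.minus_equality[of "q v \<odot>\<^bsub>V\<^esub> b" v] by (simp add: p_def V.module.M.a_comm)
    then have "inv\<^bsub>K\<^esub> q v \<odot>\<^bsub>V\<^esub> (\<ominus>\<^bsub>V\<^esub> v) = b"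
      using iq qv bV by (simp add: V.module.smult_assoc1[symmetric] V.module.smult_one)
    moreover have "inv\<^bsub>K\<^esub> q v \<odot>\<^bsub>V\<^esub> (\<ominus>\<^bsub>V\<^esub> v) = (\<ominus>\<^bsub>K\<^esub> (inv\<^bsub>K\<^esub> q v)) \<odot>\<^bsub>V\<^esub> v"
      using iq vV by (simp add: V.module.smult_l_minus V.module.smult_r_minus)
    moreover have "(\<ominus>\<^bsub>K\<^esub> (inv\<^bsub>K\<^esub> q v)) \<odot>\<^bsub>V\<^esub> v \<in> V.module.span ?S"
      using v iq sub_S by (simp add: submodule.smult_closed)
    ultimately show False using b_span by simp
  qed
  have "p.ker = {\<zero>\<^bsub>V\<^esub>}"
    using ker p.f0_is_0 submodule.zero_closed[OF sub_S] by (auto simp: p.ker_def)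
  then have "inj_on p (carrier ?U)" by (intro p.Ke0_imp_inj) simp
  then have "inj_on p (V.module.span ?S)" by simp
  moreover have "p ` V.module.span ?S = N"
  proof
    show "p ` V.module.span ?S \<subseteq> N" using span_V p_closed by auto
    \<comment> \<open>This subspace contains \<open>B\<close>, hence is everything.\<close>
    let ?P = "{x \<in> carrier V. p x \<in> p ` V.module.span ?S}"
    have "submodule K ?P V"
    proof -
      have z: "p \<zero>\<^bsub>V\<^esub> = \<zero>\<^bsub>V\<^esub>" using sub by (simp add: p_id submodule.zero_closed)
      have "p (x \<oplus>\<^bsub>V\<^esub> y) \<in> p ` V.module.span ?S"
        if xy: "x \<in> ?P" "y \<in> ?P" for x y
      proof -
        obtain s t where st: "s \<in> V.module.span ?S" "t \<in> V.module.span ?S" "p x = p s" "p y = p t"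
          using xy by auto
        then have "p (x \<oplus>\<^bsub>V\<^esub> y) = p (s \<oplus>\<^bsub>V\<^esub> t)" using xy span_V by (auto simp: p_add subset_iff)
        then show ?thesis using st sub_S by (simp add: submodule.m_closed)
      qed
      moreover have "p (r \<odot>\<^bsub>V\<^esub> x) \<in> p ` V.module.span ?S"
        if rx: "r \<in> carrier K" "x \<in> ?P" for r x
      proof -
        obtain s where s: "s \<in> V.module.span ?S" "p x = p s" using rx by auto
        then have "p (r \<odot>\<^bsub>V\<^esub> x) = p (r \<odot>\<^bsub>V\<^esub> s)" using rx span_V by (auto simp: p_smult subset_iff)
        then show ?thesis using s rx sub_S by (simp add: submodule.smult_closed)
      qed
      ultimately show ?thesis
        using submodule.zero_closed[OF sub_S] V.module.module_axioms
        by (auto simp: submodule_def)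
    qed
    moreover have "B \<subseteq> ?P"
    proof
      fix x assume x: "x \<in> B"
      show "x \<in> ?P"
      proof (cases "x = b")
        case True
        have "p b = p \<zero>\<^bsub>V\<^esub>" using sub p_b by (simp add: p_id submodule.zero_closed)
        then show ?thesis using True bV submodule.zero_closed[OF sub_S] by auto
      qed (use x S_span BV in auto)
    qed
    ultimately have "V.module.span B \<subseteq> ?P" by (intro V.module.span_is_subset)
    then show "N \<subseteq> p ` V.module.span ?S" using gen p_id by (force simp: N_def)
  qed
  ultimately have bij: "bij_betw p (carrier ?U) (carrier (V\<lparr>carrier := N\<rparr>))" by (simp add: bij_betw_def)
  have "has_dimension K ?U c"
    unfolding has_dimension_def using basis_U card_of_remove[OF card b(1) c] by blast
  then show ?thesis
    using has_dimension_iso[OF U N.vectorspace_axioms hom bij] by (simp add: N_def)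
qed

section \<open>Scalars\<close>

lemma (in field) inverse_two:
  assumes "two R \<noteq> \<zero>"
  shows "inv (two R) \<in> carrier R"
    and "a \<in> carrier R \<Longrightarrow> inv (two R) \<otimes> a \<oplus> inv (two R) \<otimes> a = a"
proof -
  have two: "two R \<in> carrier R" by (simp add: two_def)
  then have h: "inv (two R) \<in> carrier R" "inv (two R) \<otimes> two R = \<one>"
    using assms field_Units by auto
  then show "inv (two R) \<in> carrier R" by simp
  assume a: "a \<in> carrier R"
  have "inv (two R) \<otimes> a \<oplus> inv (two R) \<otimes> a = inv (two R) \<otimes> two R \<otimes> a"
    using h(1) two a by (simp add: two_def r_distr l_distr)
  then show "inv (two R) \<otimes> a \<oplus> inv (two R) \<otimes> a = a" using h a by simp
qed

context vectorspace
begin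

lemma two_smult: "x \<in> carrier V \<Longrightarrow> two K \<odot>\<^bsub>V\<^esub> x = x \<oplus>\<^bsub>V\<^esub> x"
  by (simp add: two_def smult_l_distr smult_one)

lemma double_eq_zero:
  assumes "two K \<noteq> \<zero>\<^bsub>K\<^esub>" "x \<in> carrier V" "x \<oplus>\<^bsub>V\<^esub> x = \<zero>\<^bsub>V\<^esub>"
  shows "x = \<zero>\<^bsub>V\<^esub>"
proof -
  have h: "inv\<^bsub>K\<^esub> two K \<in> carrier K"
    and "inv\<^bsub>K\<^esub> two K \<otimes>\<^bsub>K\<^esub> \<one>\<^bsub>K\<^esub> \<oplus>\<^bsub>K\<^esub> inv\<^bsub>K\<^esub> two K \<otimes>\<^bsub>K\<^esub> \<one>\<^bsub>K\<^esub> = \<one>\<^bsub>K\<^esub>"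
    using inverse_two(1)[OF assms(1)] inverse_two(2)[OF assms(1), of "\<one>\<^bsub>K\<^esub>"] by auto
  then have "inv\<^bsub>K\<^esub> two K \<odot>\<^bsub>V\<^esub> (x \<oplus>\<^bsub>V\<^esub> x) = x"
    using assms(2) by (simp add: smult_r_distr smult_l_distr[symmetric] smult_one)
  then show ?thesis using assms h by simp
qed

lemma smult_eq_zero:
  assumes "r \<in> carrier K" "r \<noteq> \<zero>\<^bsub>K\<^esub>" "x \<in> carrier V" "r \<odot>\<^bsub>V\<^esub> x = \<zero>\<^bsub>V\<^esub>"
  shows "x = \<zero>\<^bsub>V\<^esub>"
  using mult_inverse[OF assms(1,3,4,2)] assms field_Units by simp

text \<open>Adding the values of the polynomial at 1 and -1 isolates \<open>2 Q\<close>; then \<open>P = - R\<close>,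
  and the value at \<open>t\<close> becomes \<open>t (t + 1) (t - 1) R\<close>, so it suffices that the field has an element
  other than 0, 1 and -1.\<close>

lemma cubic_vanishing:
  assumes inf: "infinite (carrier K)" and two: "two K \<noteq> \<zero>\<^bsub>K\<^esub>"
    and P: "P \<in> carrier V" and Q: "Q \<in> carrier V" and R: "R \<in> carrier V"
    and vanish: "\<And>t. t \<in> carrier K \<Longrightarrow> t \<odot>\<^bsub>V\<^esub> P \<oplus>\<^bsub>V\<^esub> (t \<otimes>\<^bsub>K\<^esub> t) \<odot>\<^bsub>V\<^esub> Q \<oplus>\<^bsub>V\<^esub> (t \<otimes>\<^bsub>K\<^esub> t \<otimes>\<^bsub>K\<^esub> t) \<odot>\<^bsub>V\<^esub> R = \<zero>\<^bsub>V\<^esub>"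
  shows "P = \<zero>\<^bsub>V\<^esub>" "Q = \<zero>\<^bsub>V\<^esub>" "R = \<zero>\<^bsub>V\<^esub>"
proof -
  have plus: "P \<oplus>\<^bsub>V\<^esub> Q \<oplus>\<^bsub>V\<^esub> R = \<zero>\<^bsub>V\<^esub>" using vanish[of "\<one>\<^bsub>K\<^esub>"] P Q R by (simp add: smult_one)
  have minus: "\<ominus>\<^bsub>V\<^esub> P \<oplus>\<^bsub>V\<^esub> Q \<oplus>\<^bsub>V\<^esub> \<ominus>\<^bsub>V\<^esub> R = \<zero>\<^bsub>V\<^esub>"
    using vanish[of "\<ominus>\<^bsub>K\<^esub> \<one>\<^bsub>K\<^esub>"] P Q R by (simp add: smult_l_minus smult_one R.l_minus R.r_minus)
  have "(P \<oplus>\<^bsub>V\<^esub> Q \<oplus>\<^bsub>V\<^esub> R) \<oplus>\<^bsub>V\<^esub> (\<ominus>\<^bsub>V\<^esub> P \<oplus>\<^bsub>V\<^esub> Q \<oplus>\<^bsub>V\<^esub> \<ominus>\<^bsub>V\<^esub> R) = (P \<oplus>\<^bsub>V\<^esub> \<ominus>\<^bsub>V\<^esub> P) \<oplus>\<^bsub>V\<^esub> (R \<oplus>\<^bsub>V\<^esub> \<ominus>\<^bsub>V\<^esub> R) \<oplus>\<^bsub>V\<^esub> (Q \<oplus>\<^bsub>V\<^esub> Q)"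
    using P Q R by (simp add: M.a_ac)
  also have "\<dots> = Q \<oplus>\<^bsub>V\<^esub> Q" using P Q R by (simp add: M.r_neg)
  finally have "Q \<oplus>\<^bsub>V\<^esub> Q = \<zero>\<^bsub>V\<^esub>" by (simp only: plus minus M.l_zero M.zero_closed)
  then show Q0: "Q = \<zero>\<^bsub>V\<^esub>" using double_eq_zero two Q by blast
  then have PR: "P = \<ominus>\<^bsub>V\<^esub> R" using plus P R M.minus_equality[of P R] by simp
  obtain t where t: "t \<in> carrier K" "t \<noteq> \<zero>\<^bsub>K\<^esub>" "t \<noteq> \<one>\<^bsub>K\<^esub>" "t \<noteq> \<ominus>\<^bsub>K\<^esub> \<one>\<^bsub>K\<^esub>"
  proof -
    have "infinite (carrier K - {\<zero>\<^bsub>K\<^esub>, \<one>\<^bsub>K\<^esub>, \<ominus>\<^bsub>K\<^esub> \<one>\<^bsub>K\<^esub>})" using inf by simp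
    then have "carrier K - {\<zero>\<^bsub>K\<^esub>, \<one>\<^bsub>K\<^esub>, \<ominus>\<^bsub>K\<^esub> \<one>\<^bsub>K\<^esub>} \<noteq> {}" by (metis finite.emptyI)
    then show thesis using that by blast
  qed
  let ?r = "t \<otimes>\<^bsub>K\<^esub> (t \<oplus>\<^bsub>K\<^esub> \<one>\<^bsub>K\<^esub>) \<otimes>\<^bsub>K\<^esub> (t \<oplus>\<^bsub>K\<^esub> \<ominus>\<^bsub>K\<^esub> \<one>\<^bsub>K\<^esub>)"
  have "t \<oplus>\<^bsub>K\<^esub> \<one>\<^bsub>K\<^esub> \<noteq> \<zero>\<^bsub>K\<^esub>" using t R.minus_equality[of t "\<one>\<^bsub>K\<^esub>"] by auto
  moreover have "t \<oplus>\<^bsub>K\<^esub> \<ominus>\<^bsub>K\<^esub> \<one>\<^bsub>K\<^esub> \<noteq> \<zero>\<^bsub>K\<^esub>" using t R.minus_equality[of t "\<ominus>\<^bsub>K\<^esub> \<one>\<^bsub>K\<^esub>"] by auto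
  ultimately have r: "?r \<in> carrier K" "?r \<noteq> \<zero>\<^bsub>K\<^esub>" using t by (auto simp: integral_iff)
  have "?r = t \<otimes>\<^bsub>K\<^esub> t \<otimes>\<^bsub>K\<^esub> t \<oplus>\<^bsub>K\<^esub> \<ominus>\<^bsub>K\<^esub> t"
    using t by (simp add: R.l_distr R.r_distr R.r_minus R.l_minus R.a_ac R.m_ac R.r_neg1 R.r_neg2)
  then have "?r \<odot>\<^bsub>V\<^esub> R = t \<odot>\<^bsub>V\<^esub> P \<oplus>\<^bsub>V\<^esub> (t \<otimes>\<^bsub>K\<^esub> t) \<odot>\<^bsub>V\<^esub> Q \<oplus>\<^bsub>V\<^esub> (t \<otimes>\<^bsub>K\<^esub> t \<otimes>\<^bsub>K\<^esub> t) \<odot>\<^bsub>V\<^esub> R"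
    using t R by (simp add: Q0 PR smult_l_distr smult_l_minus smult_r_minus M.a_comm)
  then show R0: "R = \<zero>\<^bsub>V\<^esub>" using smult_eq_zero[OF r R] vanish[OF t(1)] by simp
  then show "P = \<zero>\<^bsub>V\<^esub>" using PR by simp
qed

end

section \<open>Algebras and their isomorphisms\<close>

context nonassoc_algebra
begin

lemma mul_closed [simp, intro]: "x \<in> carrier A \<Longrightarrow> y \<in> carrier A \<Longrightarrow> x \<otimes> y \<in> carrier A"
  using module_hom_closed[OF mult_linear_right] by auto

lemma mul_add_right:
  "x \<in> carrier A \<Longrightarrow> y \<in> carrier A \<Longrightarrow> z \<in> carrier A \<Longrightarrow> x \<otimes> (y \<oplus> z) = x \<otimes> y \<oplus> x \<otimes> z"
  using module_hom_add[OF mult_linear_right] by auto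

lemma mul_add_left:
  "x \<in> carrier A \<Longrightarrow> y \<in> carrier A \<Longrightarrow> z \<in> carrier A \<Longrightarrow> (x \<oplus> y) \<otimes> z = x \<otimes> z \<oplus> y \<otimes> z"
  using module_hom_add[OF mult_linear_left] by auto

lemma mul_smult_right:
  "r \<in> carrier K \<Longrightarrow> x \<in> carrier A \<Longrightarrow> y \<in> carrier A \<Longrightarrow> x \<otimes> (r \<odot> y) = r \<odot> (x \<otimes> y)"
  using module_hom_smult[OF mult_linear_right] by auto

lemma mul_smult_left:
  "r \<in> carrier K \<Longrightarrow> x \<in> carrier A \<Longrightarrow> y \<in> carrier A \<Longrightarrow> (r \<odot> x) \<otimes> y = r \<odot> (x \<otimes> y)"
  using module_hom_smult[OF mult_linear_left] by auto

lemma mul_zero_right [simp]: "x \<in> carrier A \<Longrightarrow> x \<otimes> \<zero> = \<zero>"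
  using mul_smult_right[of "\<zero>\<^bsub>K\<^esub>" x \<zero>] by simp

lemma mul_zero_left [simp]: "x \<in> carrier A \<Longrightarrow> \<zero> \<otimes> x = \<zero>"
  using mul_smult_left[of "\<zero>\<^bsub>K\<^esub>" \<zero> x] by simp

end

text \<open>By commutativity, linearity in the second factor is enough.\<close>

lemma comm_nonassoc_algebraI:
  assumes "vectorspace K A"
    and "\<And>x y. x \<in> carrier A \<Longrightarrow> y \<in> carrier A \<Longrightarrow> x \<otimes>\<^bsub>A\<^esub> y \<in> carrier A"
    and "\<And>x y z. x \<in> carrier A \<Longrightarrow> y \<in> carrier A \<Longrightarrow> z \<in> carrier A \<Longrightarrow>
      x \<otimes>\<^bsub>A\<^esub> (y \<oplus>\<^bsub>A\<^esub> z) = x \<otimes>\<^bsub>A\<^esub> y \<oplus>\<^bsub>A\<^esub> x \<otimes>\<^bsub>A\<^esub> z"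
    and "\<And>r x y. r \<in> carrier K \<Longrightarrow> x \<in> carrier A \<Longrightarrow> y \<in> carrier A \<Longrightarrow>
      x \<otimes>\<^bsub>A\<^esub> (r \<odot>\<^bsub>A\<^esub> y) = r \<odot>\<^bsub>A\<^esub> (x \<otimes>\<^bsub>A\<^esub> y)"
    and "\<And>x y. x \<in> carrier A \<Longrightarrow> y \<in> carrier A \<Longrightarrow> x \<otimes>\<^bsub>A\<^esub> y = y \<otimes>\<^bsub>A\<^esub> x"
  shows "comm_nonassoc_algebra K A"
proof -
  interpret vectorspace K A by fact
  show ?thesis by unfold_locales (auto simp: module_hom_def assms)
qed

lemma algebra_homD:
  assumes "f \<in> algebra_hom K A B"
  shows "x \<in> carrier A \<Longrightarrow> f x \<in> carrier B"
    and "x \<in> carrier A \<Longrightarrow> y \<in> carrier A \<Longrightarrow> f (x \<oplus>\<^bsub>A\<^esub> y) = f x \<oplus>\<^bsub>B\<^esub> f y"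
    and "r \<in> carrier K \<Longrightarrow> x \<in> carrier A \<Longrightarrow> f (r \<odot>\<^bsub>A\<^esub> x) = r \<odot>\<^bsub>B\<^esub> f x"
    and "x \<in> carrier A \<Longrightarrow> y \<in> carrier A \<Longrightarrow> f (x \<otimes>\<^bsub>A\<^esub> y) = f x \<otimes>\<^bsub>B\<^esub> f y"
  using assms by (auto simp: algebra_hom_def module_hom_def)

lemma algebra_homI:
  assumes "\<And>x. x \<in> carrier A \<Longrightarrow> f x \<in> carrier B"
    and "\<And>x y. x \<in> carrier A \<Longrightarrow> y \<in> carrier A \<Longrightarrow> f (x \<oplus>\<^bsub>A\<^esub> y) = f x \<oplus>\<^bsub>B\<^esub> f y"
    and "\<And>r x. r \<in> carrier K \<Longrightarrow> x \<in> carrier A \<Longrightarrow> f (r \<odot>\<^bsub>A\<^esub> x) = r \<odot>\<^bsub>B\<^esub> f x"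
    and "\<And>x y. x \<in> carrier A \<Longrightarrow> y \<in> carrier A \<Longrightarrow> f (x \<otimes>\<^bsub>A\<^esub> y) = f x \<otimes>\<^bsub>B\<^esub> f y"
  shows "f \<in> algebra_hom K A B"
  using assms by (auto simp: algebra_hom_def module_hom_def)

lemma algebra_hom_zero:
  assumes "vectorspace K A" "vectorspace K B" "f \<in> algebra_hom K A B"
  shows "f \<zero>\<^bsub>A\<^esub> = \<zero>\<^bsub>B\<^esub>"
proof -
  interpret linear_map K A B f
    using assms by (intro linear_mapI) (auto simp: algebra_hom_def)
  show ?thesis by simp
qed

lemma algebra_isoD:
  assumes "f \<in> algebra_iso K A B"
  shows "f \<in> algebra_hom K A B" "bij_betw f (carrier A) (carrier B)"
  using assms by (auto simp: algebra_iso_def)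

lemma algebra_iso_comp:
  assumes "f \<in> algebra_iso K A B" "g \<in> algebra_iso K B C"
  shows "g \<circ> f \<in> algebra_iso K A C"
  using assms algebra_homD[OF algebra_isoD(1)[OF assms(1)]] algebra_homD[OF algebra_isoD(1)[OF assms(2)]]
  by (auto simp: algebra_iso_def intro!: algebra_homI intro: bij_betw_trans)

lemma algebra_iso_inv:
  assumes A: "nonassoc_algebra K A" and f: "f \<in> algebra_iso K A B"
  shows "inv_into (carrier A) f \<in> algebra_iso K B A"
proof -
  interpret nonassoc_algebra K A by fact
  note hom = algebra_homD[OF algebra_isoD(1)[OF f]]
  have bij: "bij_betw f (carrier A) (carrier B)" using f by (rule algebra_isoD)
  have g: "inv_into (carrier A) f y \<in> carrier A" "f (inv_into (carrier A) f y) = y"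
    if "y \<in> carrier B" for y
    using bij that by (auto simp: bij_betw_def f_inv_into_f inv_into_into)
  have eq: "inv_into (carrier A) f y = x" if "x \<in> carrier A" "f x = y" for x y
    using bij that by (auto simp: bij_betw_def)
  have "inv_into (carrier A) f \<in> algebra_hom K B A"
    by (rule algebra_homI) (auto simp: g hom intro!: eq)
  then show ?thesis using bij_betw_inv_into[OF bij] by (simp add: algebra_iso_def)
qed

lemma bernstein_iso_iff:
  "\<psi> \<in> bernstein_iso K S S' \<longleftrightarrow>
    \<psi> \<in> algebra_iso K (fst S) (fst S') \<and> (\<forall>x\<in>carrier (fst S). snd S' (\<psi> x) = snd S x)"
  by (simp add: bernstein_iso_def case_prod_beta)

lemma bernstein_iso_comp:
  assumes "f \<in> bernstein_iso K S S'" "g \<in> bernstein_iso K S' S''"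
  shows "g \<circ> f \<in> bernstein_iso K S S''"
  using assms algebra_homD(1)[OF algebra_isoD(1)]
  by (fastforce simp: bernstein_iso_iff intro: algebra_iso_comp)

lemma bernstein_iso_inv:
  assumes A: "nonassoc_algebra K (fst S)" and f: "f \<in> bernstein_iso K S S'"
  shows "inv_into (carrier (fst S)) f \<in> bernstein_iso K S' S"
proof -
  have "bij_betw f (carrier (fst S)) (carrier (fst S'))"
    using f by (auto simp: bernstein_iso_iff algebra_iso_def)
  then have "inv_into (carrier (fst S)) f y \<in> carrier (fst S)" "f (inv_into (carrier (fst S)) f y) = y"
    if "y \<in> carrier (fst S')" for y
    using that by (auto simp: bij_betw_def f_inv_into_f inv_into_into)
  then show ?thesis using f algebra_iso_inv[OF A]
    unfolding bernstein_iso_iff by metis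
qed

lemma (in baric_algebra) weight_simps:
  shows "x \<in> carrier A \<Longrightarrow> \<omega> x \<in> carrier K"
    and "x \<in> carrier A \<Longrightarrow> y \<in> carrier A \<Longrightarrow> \<omega> (x \<oplus> y) = \<omega> x \<oplus>\<^bsub>K\<^esub> \<omega> y"
    and "r \<in> carrier K \<Longrightarrow> x \<in> carrier A \<Longrightarrow> \<omega> (r \<odot> x) = r \<otimes>\<^bsub>K\<^esub> \<omega> x"
    and "x \<in> carrier A \<Longrightarrow> y \<in> carrier A \<Longrightarrow> \<omega> (x \<otimes> y) = \<omega> x \<otimes>\<^bsub>K\<^esub> \<omega> y"
    and "\<omega> \<zero> = \<zero>\<^bsub>K\<^esub>"
  using algebra_homD[OF weight_hom]
    algebra_hom_zero[OF vectorspace_axioms vectorspace_scalar_algebra[OF field_axioms] weight_hom]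
  by (auto simp: scalar_algebra_def)

subsection \<open>Transport of structure\<close>

text \<open>The structure that makes an injection \<open>g\<close> an isomorphism onto its image; it serves to move
  algebras into the universe.\<close>

definition transported_algebra :: "('a \<Rightarrow> 'b) \<Rightarrow> ('k, 'a) module \<Rightarrow> ('k, 'b) module" where
  "transported_algebra g A =
     (let h = inv_into (carrier A) g in
      \<lparr>carrier = g ` carrier A, mult = \<lambda>x y. g (h x \<otimes>\<^bsub>A\<^esub> h y), one = g \<one>\<^bsub>A\<^esub>, zero = g \<zero>\<^bsub>A\<^esub>,
       add = \<lambda>x y. g (h x \<oplus>\<^bsub>A\<^esub> h y), smult = \<lambda>r x. g (r \<odot>\<^bsub>A\<^esub> h x)\<rparr>)"

lemma bernstein_algebra_transport:
  assumes A: "bernstein_algebra K A \<omega>" and inj: "inj_on g (carrier A)"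
  defines "B \<equiv> transported_algebra g A" and "\<omega>' \<equiv> \<omega> \<circ> inv_into (carrier A) g"
  shows "bernstein_algebra K B \<omega>'" and "g \<in> bernstein_iso K (A, \<omega>) (B, \<omega>')"
proof -
  interpret bernstein_algebra K A \<omega> by fact
  note w = weight_simps
  have h [simp]: "inv_into (carrier A) g (g x) = x" if "x \<in> carrier A" for x
    using inj that by simp
  have B: "carrier B = g ` carrier A" "\<zero>\<^bsub>B\<^esub> = g \<zero>\<^bsub>A\<^esub>"
    "x \<oplus>\<^bsub>B\<^esub> y = g (inv_into (carrier A) g x \<oplus>\<^bsub>A\<^esub> inv_into (carrier A) g y)"
    "x \<otimes>\<^bsub>B\<^esub> y = g (inv_into (carrier A) g x \<otimes>\<^bsub>A\<^esub> inv_into (carrier A) g y)"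
    "r \<odot>\<^bsub>B\<^esub> x = g (r \<odot>\<^bsub>A\<^esub> inv_into (carrier A) g x)" for x y r
    by (simp_all add: B_def transported_algebra_def Let_def)
  have "vectorspace K B"
  proof (rule vs_criteria[OF field_axioms])
    show "\<forall>v\<in>carrier B. \<exists>neg_v\<in>carrier B. v \<oplus>\<^bsub>B\<^esub> neg_v = \<zero>\<^bsub>B\<^esub>"
    proof
      fix v assume "v \<in> carrier B"
      then obtain x where "x \<in> carrier A" "v = g x" by (auto simp: B)
      then show "\<exists>neg_v\<in>carrier B. v \<oplus>\<^bsub>B\<^esub> neg_v = \<zero>\<^bsub>B\<^esub>"
        by (intro bexI[of _ "g (\<ominus>\<^bsub>A\<^esub> x)"]) (auto simp: B M.r_neg)
    qed
  qed (auto simp: B M.a_ac smult_assoc1 smult_one smult_l_distr smult_r_distr)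
  then interpret B: comm_nonassoc_algebra K B
    by (rule comm_nonassoc_algebraI) (auto simp: B mul_add_right mul_smult_right mult_commutative)
  have "bernstein_algebra_axioms K B \<omega>'"
    using bernstein_identity by unfold_locales (auto simp: B \<omega>'_def)
  moreover have "baric_algebra_axioms K B \<omega>'"
    using weight_nonzero
    by unfold_locales (auto simp: B \<omega>'_def w scalar_algebra_def intro!: algebra_homI)
  ultimately show "bernstein_algebra K B \<omega>'"
    using B.comm_nonassoc_algebra_axioms by (simp add: bernstein_algebra_def baric_algebra_def)
  show "g \<in> bernstein_iso K (A, \<omega>) (B, \<omega>')"
    using inj by (auto simp: bernstein_iso_iff algebra_iso_def B \<omega>'_def bij_betw_def intro!: algebra_homI)
qed

lemma bernstein_algebra_in_universe:
  assumes "bernstein_algebra K A \<omega>" "|carrier A| \<le>o |UNIV :: 'u set|" "has_dimension K A c"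
  obtains B :: "('k, 'u) module" and \<omega>' g
  where "(B, \<omega>') \<in> bernstein_algebras K c" "g \<in> bernstein_iso K (A, \<omega>) (B, \<omega>')"
proof -
  obtain g :: "_ \<Rightarrow> 'u" where "inj_on g (carrier A)"
    using assms(2) card_of_ordLeq[of "carrier A" "UNIV :: 'u set"] by auto
  note tr = bernstein_algebra_transport[OF assms(1) this]
  let ?B = "transported_algebra g A"
  have "vectorspace K A" "vectorspace K ?B"
    using assms(1) tr(1)
    by (simp_all add: bernstein_algebra_def baric_algebra_def comm_nonassoc_algebra_def nonassoc_algebra_def)
  then have "has_dimension K ?B c"
    using tr(2) assms(3)
    by (intro has_dimension_iso[of K A ?B g c]) (auto simp: bernstein_iso_iff algebra_iso_def algebra_hom_def)
  then show thesis using that tr by (auto simp: bernstein_algebras_def)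
qed

subsection \<open>Isomorphism types\<close>

lemma bernstein_type_eqI:
  assumes "nonassoc_algebra K (fst S)" and f: "f \<in> bernstein_iso K S S'"
  shows "(bernstein_type K c S :: (('k, 'u) module \<times> ('u \<Rightarrow> 'k)) set) = bernstein_type K c S'"
proof -
  have "bernstein_iso K S B \<noteq> {} \<longleftrightarrow> bernstein_iso K S' B \<noteq> {}"
    for B :: "('k, 'u) module \<times> ('u \<Rightarrow> 'k)"
    using bernstein_iso_comp[OF f] bernstein_iso_comp[OF bernstein_iso_inv[OF assms]] by blast
  then show ?thesis by (simp add: bernstein_type_def)
qed

lemma four_algebra_type_eqI:
  assumes "nonassoc_algebra K N" and f: "f \<in> algebra_iso K N N'"
  shows "(four_algebra_type K c N :: ('k, 'u) module set) = four_algebra_type K c N'"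
proof -
  have "algebra_iso K N M \<noteq> {} \<longleftrightarrow> algebra_iso K N' M \<noteq> {}" for M :: "('k, 'u) module"
    using algebra_iso_comp[OF f] algebra_iso_comp[OF algebra_iso_inv[OF assms]] by blast
  then show ?thesis by (simp add: four_algebra_type_def)
qed

section \<open>Semidirect products\<close>

lemma vectorspace_mult_update:
  "vectorspace K V \<Longrightarrow> vectorspace K (V\<lparr>mult := m\<rparr>)"
  by (simp add: vectorspace_def module_def module_axioms_def abelian_group_def
      abelian_monoid_def abelian_group_axioms_def)

lemma semidirect_product_simps:
  "carrier (fst (semidirect_product K N \<Omega>)) = carrier N \<times> carrier K"
  "(x, \<alpha>) \<oplus>\<^bsub>fst (semidirect_product K N \<Omega>)\<^esub> (y, \<beta>) = (x \<oplus>\<^bsub>N\<^esub> y, \<alpha> \<oplus>\<^bsub>K\<^esub> \<beta>)"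
  "\<zero>\<^bsub>fst (semidirect_product K N \<Omega>)\<^esub> = (\<zero>\<^bsub>N\<^esub>, \<zero>\<^bsub>K\<^esub>)"
  "r \<odot>\<^bsub>fst (semidirect_product K N \<Omega>)\<^esub> (x, \<alpha>) = (r \<odot>\<^bsub>N\<^esub> x, r \<otimes>\<^bsub>K\<^esub> \<alpha>)"
  "(x, \<alpha>) \<otimes>\<^bsub>fst (semidirect_product K N \<Omega>)\<^esub> (y, \<beta>) =
     ((x \<otimes>\<^bsub>N\<^esub> y) \<oplus>\<^bsub>N\<^esub> (inv\<^bsub>K\<^esub> (two K) \<otimes>\<^bsub>K\<^esub> \<alpha>) \<odot>\<^bsub>N\<^esub> \<Omega> y \<oplus>\<^bsub>N\<^esub> (inv\<^bsub>K\<^esub> (two K) \<otimes>\<^bsub>K\<^esub> \<beta>) \<odot>\<^bsub>N\<^esub> \<Omega> x,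
      \<alpha> \<otimes>\<^bsub>K\<^esub> \<beta>)"
  "snd (semidirect_product K N \<Omega>) = snd"
  by (simp_all add: semidirect_product_def direct_sum_def scalar_algebra_def)

locale bernstein_pair = four_algebra K N for K and N :: "('k, 'a) module" (structure) +
  fixes \<Omega>
  assumes operator: "\<Omega> \<in> bernstein_operators K N" and char_not_two: "two K \<noteq> \<zero>\<^bsub>K\<^esub>"
begin

lemma op_closed [simp, intro]: "x \<in> carrier N \<Longrightarrow> \<Omega> x \<in> carrier N"
  and op_add: "x \<in> carrier N \<Longrightarrow> y \<in> carrier N \<Longrightarrow> \<Omega> (x \<oplus> y) = \<Omega> x \<oplus> \<Omega> y"
  and op_smult: "r \<in> carrier K \<Longrightarrow> x \<in> carrier N \<Longrightarrow> \<Omega> (r \<odot> x) = r \<odot> \<Omega> x"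
  and op_idem: "x \<in> carrier N \<Longrightarrow> \<Omega> (\<Omega> x) = \<Omega> x"
  and op_orth: "x \<in> carrier N \<Longrightarrow> (x \<otimes> x) \<otimes> \<Omega> x = \<zero>"
  and op_square: "x \<in> carrier N \<Longrightarrow> (\<Omega> x \<otimes> \<Omega> x) \<oplus> \<Omega> (x \<otimes> x) = x \<otimes> x"
  using operator by (auto simp: bernstein_operators_def module_hom_def)

lemma op_zero [simp]: "\<Omega> \<zero> = \<zero>"
  using op_smult[of "\<zero>\<^bsub>K\<^esub>" \<zero>] by simp

abbreviation "half \<equiv> inv\<^bsub>K\<^esub> (two K)"

lemma half_closed [simp, intro]: "half \<in> carrier K"
  using char_not_two by (rule field.inverse_two)

text \<open>The two mixed terms of a square in the semidirect product carry the factor 1/2 and are equal;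
  this is how they add up.\<close>

lemma half_smult_double:
  "r \<in> carrier K \<Longrightarrow> x \<in> carrier N \<Longrightarrow> (half \<otimes>\<^bsub>K\<^esub> r) \<odot> x \<oplus> (half \<otimes>\<^bsub>K\<^esub> r) \<odot> x = r \<odot> x"
  using field.inverse_two(2)[OF char_not_two, of r] by (simp add: smult_l_distr[symmetric])

abbreviation "S \<equiv> semidirect_product K N \<Omega>"

lemmas S_simps = semidirect_product_simps[of K N \<Omega>]

lemma semidirect_vectorspace: "vectorspace K (fst S)"
  unfolding semidirect_product_def fst_conv
  by (intro vectorspace_mult_update direct_sum_is_vs vectorspace_scalar_algebra
      vectorspace_axioms field_axioms)

lemma semidirect_algebra: "comm_nonassoc_algebra K (fst S)"
  by (rule comm_nonassoc_algebraI[OF semidirect_vectorspace])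
    (auto simp: S_simps op_add op_smult mul_add_right mul_smult_right smult_l_distr smult_r_distr
      smult_assoc1[symmetric] M.a_ac R.m_ac R.r_distr R.l_distr mult_commutative)

lemma semidirect_square:
  "x \<in> carrier N \<Longrightarrow> \<alpha> \<in> carrier K \<Longrightarrow>
    (x, \<alpha>) \<otimes>\<^bsub>fst S\<^esub> (x, \<alpha>) = ((x \<otimes> x) \<oplus> \<alpha> \<odot> \<Omega> x, \<alpha> \<otimes>\<^bsub>K\<^esub> \<alpha>)"
  by (simp add: S_simps M.a_assoc half_smult_double)

text \<open>With \<open>s = x\<^sup>2\<close> and \<open>u = \<Omega> x\<close>, the square of \<open>(x, \<alpha>)\<close> is \<open>(s + \<alpha> u, \<alpha>\<^sup>2)\<close>. Squaring again, the
  axioms \<open>s\<^sup>2 = 0\<close> and \<open>s u = 0\<close> leave \<open>\<alpha>\<^sup>2 (u\<^sup>2 + \<Omega> s + \<alpha> u)\<close> in the first component, by \<open>\<Omega> u = u\<close>,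
  and \<open>u\<^sup>2 + \<Omega> s = s\<close> turns this into \<open>\<alpha>\<^sup>2 (s + \<alpha> u)\<close>.\<close>

lemma semidirect_bernstein: "bernstein_algebra K (fst S) (snd S)"
proof -
  interpret S: comm_nonassoc_algebra K "fst S" by (rule semidirect_algebra)
  have "bernstein_algebra_axioms K (fst S) (snd S)"
  proof
    fix a assume "a \<in> carrier (fst S)"
    then obtain x \<alpha> where x: "a = (x, \<alpha>)" "x \<in> carrier N" "\<alpha> \<in> carrier K" by (auto simp: S_simps)
    define s u where "s = x \<otimes> x" and "u = \<Omega> x"
    have su: "s \<in> carrier N" "u \<in> carrier N" using x by (auto simp: s_def u_def)
    have prods: "s \<otimes> s = \<zero>" "s \<otimes> u = \<zero>" "u \<otimes> s = \<zero>" "\<Omega> u = u" "u \<otimes> u \<oplus> \<Omega> s = s"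
      using x square_square_zero op_orth op_idem op_square mult_commutative[of u s] su
      by (auto simp: s_def u_def)
    let ?q = "\<alpha> \<otimes>\<^bsub>K\<^esub> \<alpha>"
    have "(s \<oplus> \<alpha> \<odot> u) \<otimes> (s \<oplus> \<alpha> \<odot> u) = ?q \<odot> (u \<otimes> u)"
      using x su prods by (simp add: mul_add_left mul_add_right mul_smult_left mul_smult_right smult_assoc1)
    moreover have "\<Omega> (s \<oplus> \<alpha> \<odot> u) = \<Omega> s \<oplus> \<alpha> \<odot> u"
      using x su prods by (simp add: op_add op_smult)
    moreover have "?q \<odot> (u \<otimes> u) \<oplus> ?q \<odot> (\<Omega> s \<oplus> \<alpha> \<odot> u) = ?q \<odot> ((u \<otimes> u \<oplus> \<Omega> s) \<oplus> \<alpha> \<odot> u)"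
      using x su by (simp add: smult_r_distr M.a_assoc)
    ultimately show "(a \<otimes>\<^bsub>fst S\<^esub> a) \<otimes>\<^bsub>fst S\<^esub> (a \<otimes>\<^bsub>fst S\<^esub> a) = (snd S a \<otimes>\<^bsub>K\<^esub> snd S a) \<odot>\<^bsub>fst S\<^esub> (a \<otimes>\<^bsub>fst S\<^esub> a)"
      using x su prods
      by (simp add: semidirect_square s_def[symmetric] u_def[symmetric]) (simp add: S_simps)
  qed
  moreover have "baric_algebra_axioms K (fst S) (snd S)"
  proof
    show "snd S \<in> algebra_hom K (fst S) (scalar_algebra K)"
      by (rule algebra_homI) (auto simp: S_simps scalar_algebra_def)
    show "\<exists>x\<in>carrier (fst S). snd S x \<noteq> \<zero>\<^bsub>K\<^esub>"
      by (rule bexI[of _ "(\<zero>, \<one>\<^bsub>K\<^esub>)"]) (auto simp: S_simps)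
  qed
  ultimately show ?thesis
    using semidirect_algebra by (simp add: bernstein_algebra_def baric_algebra_def)
qed

text \<open>The kernel of the weight is \<open>N \<times> {0}\<close>, a copy of \<open>N\<close>.\<close>

lemma semidirect_dimension:
  assumes "has_dimension K N c"
  shows "has_dimension K (fst S) (cone +c c)"
proof (rule has_dimension_from_hyperplane[OF semidirect_vectorspace])
  interpret S: bernstein_algebra K "fst S" "snd S" by (rule semidirect_bernstein)
  show w: "snd S \<in> module_hom K (fst S) (scalar_algebra K)"
    using S.weight_hom by (simp add: algebra_hom_def)
  show "(\<zero>, \<one>\<^bsub>K\<^esub>) \<in> carrier (fst S)" "snd S (\<zero>, \<one>\<^bsub>K\<^esub>) = \<one>\<^bsub>K\<^esub>" by (auto simp: S_simps)
  let ?N' = "(fst S)\<lparr>carrier := {x \<in> carrier (fst S). snd S x = \<zero>\<^bsub>K\<^esub>}\<rparr>"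
  have "subspace K {x \<in> carrier (fst S). snd S x = \<zero>\<^bsub>K\<^esub>} (fst S)"
    using S.vectorspace_axioms S.module_axioms by (auto simp: subspace_def submodule_def S_simps)
  then have "vectorspace K ?N'" by (rule S.subspace_is_vs)
  then show "has_dimension K ?N' c"
    using vectorspace_axioms
    by (rule_tac has_dimension_iso[OF _ _ _ _ assms, where f = "\<lambda>x. (x, \<zero>\<^bsub>K\<^esub>)"])
      (auto simp: module_hom_def S_simps bij_betw_def inj_on_def)
qed

text \<open>A Bernstein algebra with an idempotent \<open>e\<close> of weight 1 is the semidirect product of any copy \<open>N\<close>
  of the kernel of its weight by the operator that corresponds to \<open>x \<mapsto> 2 e x\<close>. The copy is given by
  \<open>f\<close> rather than taken to be the kernel itself, for two uses: an algebra has to be compared with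
  the chosen representative of its kernel's type, and a second semidirect product over \<open>N\<close> contains
  \<open>N\<close> as \<open>N \<times> {0}\<close>, twisted by an automorphism.\<close>

lemma semidirect_iso:
  assumes A: "bernstein_algebra K A \<omega>"
    and e: "e \<in> carrier A" "\<omega> e = \<one>\<^bsub>K\<^esub>" "e \<otimes>\<^bsub>A\<^esub> e = e"
    and f: "f \<in> algebra_hom K N A"
    and bij: "bij_betw f (carrier N) {a \<in> carrier A. \<omega> a = \<zero>\<^bsub>K\<^esub>}"
    and peirce: "\<And>x. x \<in> carrier N \<Longrightarrow> f (\<Omega> x) = e \<otimes>\<^bsub>A\<^esub> f x \<oplus>\<^bsub>A\<^esub> e \<otimes>\<^bsub>A\<^esub> f x"
  shows "(\<lambda>(x, \<alpha>). f x \<oplus>\<^bsub>A\<^esub> \<alpha> \<odot>\<^bsub>A\<^esub> e) \<in> bernstein_iso K S (A, \<omega>)"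
proof -
  interpret A: bernstein_algebra K A \<omega> by fact
  note w = A.weight_simps
  note hom = algebra_homD[OF f]
  have wf: "\<omega> (f x) = \<zero>\<^bsub>K\<^esub>" if "x \<in> carrier N" for x
    using bij that by (auto simp: bij_betw_def)
  let ?\<psi> = "\<lambda>(x, \<alpha>). f x \<oplus>\<^bsub>A\<^esub> \<alpha> \<odot>\<^bsub>A\<^esub> e"
  have wpsi: "\<omega> (f x \<oplus>\<^bsub>A\<^esub> \<alpha> \<odot>\<^bsub>A\<^esub> e) = \<alpha>" if "x \<in> carrier N" "\<alpha> \<in> carrier K" for x \<alpha>
    using that e by (simp add: w hom wf)
  have half2: "(half \<otimes>\<^bsub>K\<^esub> r) \<odot>\<^bsub>A\<^esub> f (\<Omega> x) = r \<odot>\<^bsub>A\<^esub> (e \<otimes>\<^bsub>A\<^esub> f x)"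
    if "x \<in> carrier N" "r \<in> carrier K" for x r
    using that e hom field.inverse_two(2)[OF char_not_two that(2)]
    by (simp add: peirce A.smult_r_distr A.smult_l_distr[symmetric])
  have "?\<psi> \<in> algebra_hom K (fst S) A"
  proof (rule algebra_homI)
    fix a b assume "a \<in> carrier (fst S)" "b \<in> carrier (fst S)"
    then obtain x \<alpha> y \<beta> where ab: "a = (x, \<alpha>)" "b = (y, \<beta>)"
      and c: "x \<in> carrier N" "y \<in> carrier N" "\<alpha> \<in> carrier K" "\<beta> \<in> carrier K"
      by (auto simp: S_simps)
    show "?\<psi> (a \<otimes>\<^bsub>fst S\<^esub> b) = ?\<psi> a \<otimes>\<^bsub>A\<^esub> ?\<psi> b"
      using c e A.mult_commutative[of "f x" e] by (simp add: ab S_simps hom half2)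
        (simp add: hom A.mul_add_left A.mul_add_right A.mul_smult_left A.mul_smult_right
          A.smult_r_distr A.smult_assoc1[symmetric] A.M.a_ac R.m_ac)
  qed (use e in \<open>auto simp: S_simps hom A.smult_l_distr A.smult_r_distr A.smult_assoc1 A.M.a_ac\<close>)
  moreover have "inj_on ?\<psi> (carrier (fst S))"
  proof (rule inj_onI)
    fix a b assume "a \<in> carrier (fst S)" "b \<in> carrier (fst S)" and eq: "?\<psi> a = ?\<psi> b"
    then obtain x \<alpha> y \<beta> where ab: "a = (x, \<alpha>)" "b = (y, \<beta>)"
      and c: "x \<in> carrier N" "y \<in> carrier N" "\<alpha> \<in> carrier K" "\<beta> \<in> carrier K"
      by (auto simp: S_simps)
    have \<alpha>: "\<alpha> = \<beta>" using eq wpsi[of x \<alpha>] wpsi[of y \<beta>] c by (simp add: ab)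
    then have "f x = f y" using eq c e hom by (simp add: ab)
    then have "x = y" using bij c by (auto simp: bij_betw_def inj_on_def)
    then show "a = b" using \<alpha> ab by simp
  qed
  moreover have "?\<psi> ` carrier (fst S) = carrier A"
  proof
    show "?\<psi> ` carrier (fst S) \<subseteq> carrier A" using e hom by (auto simp: S_simps)
    show "carrier A \<subseteq> ?\<psi> ` carrier (fst S)"
    proof
      fix a assume a: "a \<in> carrier A"
      let ?n = "a \<oplus>\<^bsub>A\<^esub> (\<ominus>\<^bsub>K\<^esub> \<omega> a) \<odot>\<^bsub>A\<^esub> e"
      have "?n \<in> {a \<in> carrier A. \<omega> a = \<zero>\<^bsub>K\<^esub>}"
        using a e by (simp add: w R.r_neg)
      then have "?n \<in> f ` carrier N" using bij by (simp only: bij_betw_def)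
      then obtain x where x: "x \<in> carrier N" "?n = f x" by (elim imageE)
      have "?\<psi> (x, \<omega> a) = a"
        using a e by (simp add: x(2)[symmetric] w A.smult_l_minus A.M.a_assoc A.M.l_neg)
      then show "a \<in> ?\<psi> ` carrier (fst S)"
        using x a w(1) by (intro image_eqI[of _ _ "(x, \<omega> a)"]) (auto simp: S_simps)
    qed
  qed
  ultimately have "?\<psi> \<in> algebra_iso K (fst S) A" by (simp add: algebra_iso_def bij_betw_def)
  then show ?thesis using wpsi by (auto simp: bernstein_iso_iff S_simps)
qed

end

section \<open>The Peirce decomposition of a Bernstein algebra\<close>

context bernstein_algebra
begin

abbreviation "weight_kernel \<equiv> {x \<in> carrier A. \<omega> x = \<zero>\<^bsub>K\<^esub>}"

text \<open>On the kernel the right-hand side of the Bernstein identity is zero.\<close>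

lemma kernel_four_algebra: "four_algebra K (A\<lparr>carrier := weight_kernel\<rparr>)"
proof -
  have "subspace K weight_kernel A"
    using vectorspace_axioms module_axioms by (auto simp: subspace_def submodule_def weight_simps)
  then have "vectorspace K (A\<lparr>carrier := weight_kernel\<rparr>)" by (rule subspace_is_vs)
  then have "comm_nonassoc_algebra K (A\<lparr>carrier := weight_kernel\<rparr>)"
    by (rule comm_nonassoc_algebraI)
      (auto simp: weight_simps mul_add_right mul_smult_right mult_commutative)
  moreover have "four_algebra_axioms (A\<lparr>carrier := weight_kernel\<rparr>)"
    by unfold_locales (auto simp: bernstein_identity)
  ultimately show ?thesis by (simp add: four_algebra_def)
qed

text \<open>The square of an element of weight 1.\<close>

lemma idempotent_exists:
  obtains e where "e \<in> carrier A" "\<omega> e = \<one>\<^bsub>K\<^esub>" "e \<otimes> e = e"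
proof -
  obtain x where x: "x \<in> carrier A" "\<omega> x \<noteq> \<zero>\<^bsub>K\<^esub>" using weight_nonzero by blast
  then have i: "inv\<^bsub>K\<^esub> \<omega> x \<in> carrier K" "inv\<^bsub>K\<^esub> \<omega> x \<otimes>\<^bsub>K\<^esub> \<omega> x = \<one>\<^bsub>K\<^esub>"
    using field_Units weight_simps(1) by auto
  define a where "a = inv\<^bsub>K\<^esub> \<omega> x \<odot> x"
  have a: "a \<in> carrier A" "\<omega> a = \<one>\<^bsub>K\<^esub>" using x i by (auto simp: a_def weight_simps)
  then show thesis
    using bernstein_identity[of a] by (intro that[of "a \<otimes> a"]) (auto simp: weight_simps smult_one)
qed

text \<open>For \<open>x\<close> of weight 0, put \<open>u = 2 e x\<close> and \<open>s = x\<^sup>2\<close>. Then \<open>a = e + t x\<close> has weight 1 and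
  \<open>a\<^sup>2 = e + t u + t\<^sup>2 s\<close>, so that \<open>(a\<^sup>2)\<^sup>2 = a\<^sup>2\<close> is a polynomial identity in \<open>t\<close>. Its coefficient of
  \<open>t\<close> gives \<open>2 e u = u\<close>, that of \<open>t\<^sup>2\<close> gives \<open>u\<^sup>2 + 2 e s = s\<close>, that of \<open>t\<^sup>3\<close> gives \<open>2 u s = 0\<close>;
  the coefficient of \<open>t\<^sup>4\<close> is \<open>s\<^sup>2 = 0\<close>.\<close>

lemma peirce_identities:
  assumes inf: "infinite (carrier K)" and two: "two K \<noteq> \<zero>\<^bsub>K\<^esub>"
    and e: "e \<in> carrier A" "\<omega> e = \<one>\<^bsub>K\<^esub>" "e \<otimes> e = e"
    and x: "x \<in> carrier A" "\<omega> x = \<zero>\<^bsub>K\<^esub>"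
  defines "\<Omega> \<equiv> \<lambda>y. e \<otimes> y \<oplus> e \<otimes> y"
  shows "\<Omega> (\<Omega> x) = \<Omega> x" "(x \<otimes> x) \<otimes> \<Omega> x = \<zero>" "\<Omega> x \<otimes> \<Omega> x \<oplus> \<Omega> (x \<otimes> x) = x \<otimes> x"
proof -
  define u s where "u = \<Omega> x" and "s = x \<otimes> x"
  have us: "u \<in> carrier A" "s \<in> carrier A" using e x by (auto simp: u_def s_def \<Omega>_def)
  have O: "\<Omega> y \<in> carrier A" if "y \<in> carrier A" for y using e that by (simp add: \<Omega>_def)
  have ss: "s \<otimes> s = \<zero>" using bernstein_identity[OF x(1)] x by (simp add: s_def)
  define P Q R where "P = \<Omega> u \<oplus> \<ominus> u" and "Q = u \<otimes> u \<oplus> \<Omega> s \<oplus> \<ominus> s" and "R = u \<otimes> s \<oplus> u \<otimes> s"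
  have PQR: "P \<in> carrier A" "Q \<in> carrier A" "R \<in> carrier A"
    using us O by (auto simp: P_def Q_def R_def)
  have "t \<odot> P \<oplus> (t \<otimes>\<^bsub>K\<^esub> t) \<odot> Q \<oplus> (t \<otimes>\<^bsub>K\<^esub> t \<otimes>\<^bsub>K\<^esub> t) \<odot> R = \<zero>" if t: "t \<in> carrier K" for t
  proof -
    define a where "a = e \<oplus> t \<odot> x"
    define b where "b = t \<odot> u \<oplus> (t \<otimes>\<^bsub>K\<^esub> t) \<odot> s"
    have a: "a \<in> carrier A" "\<omega> a = \<one>\<^bsub>K\<^esub>" using e x t by (auto simp: a_def weight_simps)
    have b: "b \<in> carrier A" using us t by (simp add: b_def)
    have aa: "a \<otimes> a = e \<oplus> b"
      using e x t mult_commutative[of x e]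
      by (simp add: a_def b_def u_def s_def \<Omega>_def mul_add_left mul_add_right mul_smult_left
          mul_smult_right smult_r_distr smult_assoc1 M.a_ac)
    have "e \<oplus> (\<Omega> b \<oplus> b \<otimes> b) = (e \<oplus> b) \<otimes> (e \<oplus> b)"
      using e b mult_commutative[of b e]
      by (simp add: \<Omega>_def mul_add_left mul_add_right M.a_ac)
    also have "\<dots> = e \<oplus> b"
      using bernstein_identity[OF a(1)] a e b by (simp add: aa smult_one)
    finally have eq: "\<Omega> b \<oplus> b \<otimes> b = b" using e b O by simp
    have "\<Omega> b = t \<odot> \<Omega> u \<oplus> (t \<otimes>\<^bsub>K\<^esub> t) \<odot> \<Omega> s"
      using e us t by (simp add: b_def \<Omega>_def mul_add_right mul_smult_right smult_r_distr M.a_ac)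
    moreover have "b \<otimes> b = (t \<otimes>\<^bsub>K\<^esub> t) \<odot> (u \<otimes> u) \<oplus> (t \<otimes>\<^bsub>K\<^esub> t \<otimes>\<^bsub>K\<^esub> t) \<odot> R"
      using us t ss mult_commutative[of s u]
      by (simp add: b_def R_def mul_add_left mul_add_right mul_smult_left mul_smult_right
          smult_r_distr smult_assoc1 M.a_ac)
    ultimately have "t \<odot> P \<oplus> (t \<otimes>\<^bsub>K\<^esub> t) \<odot> Q \<oplus> (t \<otimes>\<^bsub>K\<^esub> t \<otimes>\<^bsub>K\<^esub> t) \<odot> R = (\<Omega> b \<oplus> b \<otimes> b) \<oplus> \<ominus> b"
      using us t O PQR
      by (simp add: P_def Q_def b_def smult_r_distr smult_r_minus M.minus_add M.a_ac)
    also have "\<dots> = \<zero>" using b by (simp add: eq M.r_neg)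
    finally show ?thesis .
  qed
  note zero = cubic_vanishing[OF inf two PQR this]
  have diff: "y = z" if "y \<oplus> \<ominus> z = \<zero>" "y \<in> carrier A" "z \<in> carrier A" for y z
    using that by (simp add: M.minus_eq[symmetric])
  show "\<Omega> (\<Omega> x) = \<Omega> x" using diff[of "\<Omega> u" u] zero(1) us O by (simp add: P_def u_def)
  show "\<Omega> x \<otimes> \<Omega> x \<oplus> \<Omega> (x \<otimes> x) = x \<otimes> x"
    using diff[of "u \<otimes> u \<oplus> \<Omega> s" s] zero(2) us O by (simp add: Q_def u_def s_def)
  have "u \<otimes> s = \<zero>" using double_eq_zero[OF two, of "u \<otimes> s"] zero(3) us by (simp add: R_def)
  then show "(x \<otimes> x) \<otimes> \<Omega> x = \<zero>" using mult_commutative us by (simp add: u_def s_def)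
qed

text \<open>The operator \<open>x \<mapsto> 2 e x\<close> on the kernel, pulled back along \<open>f\<close>. All required identities hold in \<open>A\<close>
  by \<open>peirce_identities\<close> and are reflected by the injective map \<open>f\<close>.\<close>

lemma peirce_operator:
  fixes N :: "('a, 'n) module"
  assumes inf: "infinite (carrier K)" and two: "two K \<noteq> \<zero>\<^bsub>K\<^esub>"
    and e: "e \<in> carrier A" "\<omega> e = \<one>\<^bsub>K\<^esub>" "e \<otimes> e = e"
    and N: "four_algebra K N" and f: "f \<in> algebra_hom K N A"
    and bij: "bij_betw f (carrier N) weight_kernel"
  obtains \<Omega> where "\<Omega> \<in> bernstein_operators K N"
    and "\<And>x. x \<in> carrier N \<Longrightarrow> f (\<Omega> x) = e \<otimes> f x \<oplus> e \<otimes> f x"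
proof
  interpret N: four_algebra K N by fact
  let ?g = "\<lambda>x. inv_into (carrier N) f (e \<otimes> f x \<oplus> e \<otimes> f x)"
  let ?\<Omega> = "restrict ?g (carrier N)"
  note hom = algebra_homD[OF f]
  have ker: "f x \<in> carrier A" "\<omega> (f x) = \<zero>\<^bsub>K\<^esub>" if "x \<in> carrier N" for x
    using bij that by (auto simp: bij_betw_def)
  have "e \<otimes> f x \<oplus> e \<otimes> f x \<in> f ` carrier N" if "x \<in> carrier N" for x
    using bij e ker[OF that] by (auto simp: bij_betw_def weight_simps)
  then have \<Omega>: "?\<Omega> x \<in> carrier N" "f (?\<Omega> x) = e \<otimes> f x \<oplus> e \<otimes> f x" if "x \<in> carrier N" for x
    using that by (auto simp: f_inv_into_f inv_into_into)
  then show "\<And>x. x \<in> carrier N \<Longrightarrow> f (?\<Omega> x) = e \<otimes> f x \<oplus> e \<otimes> f x" by blast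
  have eqI: "x = y" if "x \<in> carrier N" "y \<in> carrier N" "f x = f y" for x y
    using bij that by (auto simp: bij_betw_def inj_on_def)
  have f0: "f \<zero>\<^bsub>N\<^esub> = \<zero>"
    using algebra_hom_zero[OF N.vectorspace_axioms vectorspace_axioms f] .
  note peirce = peirce_identities[OF inf two e ker]
  note simps = \<Omega> hom f0 N.mul_closed
  have "?\<Omega> \<in> module_hom K N N"
    unfolding module_hom_def
  proof (intro CollectI conjI allI impI)
    show "?\<Omega> \<in> carrier N \<rightarrow> carrier N" using \<Omega> by auto
    fix x y assume "x \<in> carrier N \<and> y \<in> carrier N"
    then show "?\<Omega> (x \<oplus>\<^bsub>N\<^esub> y) = ?\<Omega> x \<oplus>\<^bsub>N\<^esub> ?\<Omega> y"
      using e by (intro eqI) (simp_all add: simps mul_add_right M.a_ac del: restrict_apply restrict_apply')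
  next
    fix r x assume "r \<in> carrier K \<and> x \<in> carrier N"
    then show "?\<Omega> (r \<odot>\<^bsub>N\<^esub> x) = r \<odot>\<^bsub>N\<^esub> ?\<Omega> x"
      using e by (intro eqI)
        (simp_all add: simps mul_smult_right smult_r_distr del: restrict_apply restrict_apply')
  qed
  moreover have "?\<Omega> (?\<Omega> x) = ?\<Omega> x \<and> (x \<otimes>\<^bsub>N\<^esub> x) \<otimes>\<^bsub>N\<^esub> ?\<Omega> x = \<zero>\<^bsub>N\<^esub> \<and>
      (?\<Omega> x \<otimes>\<^bsub>N\<^esub> ?\<Omega> x) \<oplus>\<^bsub>N\<^esub> ?\<Omega> (x \<otimes>\<^bsub>N\<^esub> x) = x \<otimes>\<^bsub>N\<^esub> x" if "x \<in> carrier N" for x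
    using that peirce[OF that that]
    by (intro conjI eqI) (simp_all add: simps del: restrict_apply restrict_apply')
  ultimately show "?\<Omega> \<in> bernstein_operators K N"
    unfolding bernstein_operators_def by (simp del: restrict_apply restrict_apply')
qed

end

section \<open>Equivalent operators and isomorphic semidirect products\<close>

text \<open>An isomorphism preserves weights, so it has the form \<open>(x, 0) \<mapsto> (f x, 0)\<close> and \<open>(0, 1) \<mapsto> (v, 1)\<close>.
  The two equations express that it is multiplicative on \<open>(x, 0)(0, 1)\<close> and on \<open>(0, 1)(0, 1)\<close>. The
  4-algebras may differ: the existence of \<open>f\<close> then shows that they have the same type, which the
  injectivity of \<open>\<xi>\<close> requires.\<close>

lemma semidirect_iso_components:
  assumes "bernstein_pair K N \<Omega>" and "bernstein_pair K N' \<Omega>'"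
    and psi: "\<psi> \<in> bernstein_iso K (semidirect_product K N \<Omega>) (semidirect_product K N' \<Omega>')"
  obtains f v where "f \<in> algebra_iso K N N'" and "v \<in> carrier N'"
    and "\<And>x. x \<in> carrier N \<Longrightarrow> \<Omega>' (f x) \<oplus>\<^bsub>N'\<^esub> (f x \<otimes>\<^bsub>N'\<^esub> v \<oplus>\<^bsub>N'\<^esub> f x \<otimes>\<^bsub>N'\<^esub> v) = f (\<Omega> x)"
    and "\<Omega>' v \<oplus>\<^bsub>N'\<^esub> v \<otimes>\<^bsub>N'\<^esub> v = v"
proof -
  interpret P: bernstein_pair K N \<Omega> by fact
  interpret P': bernstein_pair K N' \<Omega>' by fact
  have iso: "\<psi> \<in> algebra_iso K (fst P.S) (fst P'.S)"
    and weight: "\<And>p. p \<in> carrier (fst P.S) \<Longrightarrow> snd (\<psi> p) = snd p"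
    using psi by (auto simp: bernstein_iso_iff semidirect_product_simps(6))
  note hom = algebra_homD[OF algebra_isoD(1)[OF iso]]
  have bij: "bij_betw \<psi> (carrier (fst P.S)) (carrier (fst P'.S))" using iso by (rule algebra_isoD)
  define f where "f x = fst (\<psi> (x, \<zero>\<^bsub>K\<^esub>))" for x
  define v where "v = fst (\<psi> (\<zero>\<^bsub>N\<^esub>, \<one>\<^bsub>K\<^esub>))"
  have psi_f: "\<psi> (x, \<zero>\<^bsub>K\<^esub>) = (f x, \<zero>\<^bsub>K\<^esub>)" if "x \<in> carrier N" for x
    using weight[of "(x, \<zero>\<^bsub>K\<^esub>)"] that by (simp add: f_def P.S_simps prod_eq_iff)
  have psi_v: "\<psi> (\<zero>\<^bsub>N\<^esub>, \<one>\<^bsub>K\<^esub>) = (v, \<one>\<^bsub>K\<^esub>)"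
    using weight[of "(\<zero>\<^bsub>N\<^esub>, \<one>\<^bsub>K\<^esub>)"] by (simp add: v_def P.S_simps prod_eq_iff)
  have f_closed: "f x \<in> carrier N'" if "x \<in> carrier N" for x
    using hom(1)[of "(x, \<zero>\<^bsub>K\<^esub>)"] that by (simp add: psi_f P.S_simps P'.S_simps)
  have v_closed: "v \<in> carrier N'"
    using hom(1)[of "(\<zero>\<^bsub>N\<^esub>, \<one>\<^bsub>K\<^esub>)"] by (simp add: psi_v P.S_simps P'.S_simps)
  have f_add: "f (x \<oplus>\<^bsub>N\<^esub> y) = f x \<oplus>\<^bsub>N'\<^esub> f y" if "x \<in> carrier N" "y \<in> carrier N" for x y
    using hom(2)[of "(x, \<zero>\<^bsub>K\<^esub>)" "(y, \<zero>\<^bsub>K\<^esub>)"] that by (simp add: psi_f P.S_simps P'.S_simps)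
  have f_smult: "f (r \<odot>\<^bsub>N\<^esub> x) = r \<odot>\<^bsub>N'\<^esub> f x" if "r \<in> carrier K" "x \<in> carrier N" for r x
    using hom(3)[of r "(x, \<zero>\<^bsub>K\<^esub>)"] that by (simp add: psi_f P.S_simps P'.S_simps)
  have f_mult: "f (x \<otimes>\<^bsub>N\<^esub> y) = f x \<otimes>\<^bsub>N'\<^esub> f y" if "x \<in> carrier N" "y \<in> carrier N" for x y
    using hom(4)[of "(x, \<zero>\<^bsub>K\<^esub>)" "(y, \<zero>\<^bsub>K\<^esub>)"] that
    by (simp add: psi_f f_closed P.S_simps P'.S_simps)
  show thesis
  proof
    have "inj_on f (carrier N)"
    proof (rule inj_onI)
      fix x y assume "x \<in> carrier N" "y \<in> carrier N" "f x = f y"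
      then have "(x, \<zero>\<^bsub>K\<^esub>) = (y, \<zero>\<^bsub>K\<^esub>)"
        using bij psi_f by (intro inj_onD[of \<psi> "carrier (fst P.S)"]) (auto simp: bij_betw_def P.S_simps)
      then show "x = y" by simp
    qed
    moreover have "f ` carrier N = carrier N'"
    proof
      show "carrier N' \<subseteq> f ` carrier N"
      proof
        fix y assume "y \<in> carrier N'"
        then have "(y, \<zero>\<^bsub>K\<^esub>) \<in> \<psi> ` carrier (fst P.S)"
          using bij by (simp add: bij_betw_def P'.S_simps)
        then obtain p where "p \<in> carrier (fst P.S)" "\<psi> p = (y, \<zero>\<^bsub>K\<^esub>)" by auto
        moreover from this have "snd p = \<zero>\<^bsub>K\<^esub>" using weight[of p] by simp
        ultimately have "fst p \<in> carrier N" "f (fst p) = y"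
          by (auto simp: f_def P.S_simps)
        then show "y \<in> f ` carrier N" by blast
      qed
    qed (auto simp: f_closed)
    ultimately show "f \<in> algebra_iso K N N'"
      by (auto simp: algebra_iso_def bij_betw_def f_closed f_add f_smult f_mult intro!: algebra_homI)
    show "v \<in> carrier N'" by (rule v_closed)
    show "\<Omega>' v \<oplus>\<^bsub>N'\<^esub> v \<otimes>\<^bsub>N'\<^esub> v = v"
      using hom(4)[of "(\<zero>\<^bsub>N\<^esub>, \<one>\<^bsub>K\<^esub>)" "(\<zero>\<^bsub>N\<^esub>, \<one>\<^bsub>K\<^esub>)"] v_closed
        P.semidirect_square[of "\<zero>\<^bsub>N\<^esub>" "\<one>\<^bsub>K\<^esub>"] P'.semidirect_square[of v "\<one>\<^bsub>K\<^esub>"]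
      by (simp add: psi_v P.S_simps(1) P'.smult_one P'.M.a_comm)
    fix x assume x: "x \<in> carrier N"
    have "f (P.half \<odot>\<^bsub>N\<^esub> \<Omega> x) = f x \<otimes>\<^bsub>N'\<^esub> v \<oplus>\<^bsub>N'\<^esub> P.half \<odot>\<^bsub>N'\<^esub> \<Omega>' (f x)"
      using hom(4)[of "(x, \<zero>\<^bsub>K\<^esub>)" "(\<zero>\<^bsub>N\<^esub>, \<one>\<^bsub>K\<^esub>)"] x v_closed
      by (simp add: psi_v psi_f f_closed P.S_simps P'.S_simps)
    then have half: "P.half \<odot>\<^bsub>N'\<^esub> f (\<Omega> x) = f x \<otimes>\<^bsub>N'\<^esub> v \<oplus>\<^bsub>N'\<^esub> P.half \<odot>\<^bsub>N'\<^esub> \<Omega>' (f x)"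
      using x by (simp add: f_smult)
    have double: "P.half \<odot>\<^bsub>N'\<^esub> y \<oplus>\<^bsub>N'\<^esub> P.half \<odot>\<^bsub>N'\<^esub> y = y" if "y \<in> carrier N'" for y
      using P'.half_smult_double[of "\<one>\<^bsub>K\<^esub>" y] that by (simp add: P'.smult_one)
    have "f (\<Omega> x) = (f x \<otimes>\<^bsub>N'\<^esub> v \<oplus>\<^bsub>N'\<^esub> P.half \<odot>\<^bsub>N'\<^esub> \<Omega>' (f x))
        \<oplus>\<^bsub>N'\<^esub> (f x \<otimes>\<^bsub>N'\<^esub> v \<oplus>\<^bsub>N'\<^esub> P.half \<odot>\<^bsub>N'\<^esub> \<Omega>' (f x))"
      using double[of "f (\<Omega> x)"] x by (simp add: half f_closed)
    also have "\<dots> = (P.half \<odot>\<^bsub>N'\<^esub> \<Omega>' (f x) \<oplus>\<^bsub>N'\<^esub> P.half \<odot>\<^bsub>N'\<^esub> \<Omega>' (f x))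
        \<oplus>\<^bsub>N'\<^esub> (f x \<otimes>\<^bsub>N'\<^esub> v \<oplus>\<^bsub>N'\<^esub> f x \<otimes>\<^bsub>N'\<^esub> v)"
      using x v_closed by (simp add: f_closed P'.M.a_ac)
    finally show "\<Omega>' (f x) \<oplus>\<^bsub>N'\<^esub> (f x \<otimes>\<^bsub>N'\<^esub> v \<oplus>\<^bsub>N'\<^esub> f x \<otimes>\<^bsub>N'\<^esub> v) = f (\<Omega> x)"
      using x by (simp add: double f_closed)
  qed
qed

text \<open>From a witness \<open>(v, f)\<close> one gets the isomorphism \<open>(x, \<alpha>) \<mapsto> (f x + \<alpha> v, \<alpha>)\<close>, by applying
  \<open>semidirect_iso\<close> to the idempotent \<open>(v, 1)\<close> of the second semidirect product. The converse is
  \<open>semidirect_iso_components\<close>.\<close>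

lemma bernstein_operator_equiv_iff:
  fixes N :: "('k, 'a) module"
  assumes N: "four_algebra K N" and two: "two K \<noteq> \<zero>\<^bsub>K\<^esub>"
  shows "(\<Omega>, \<Omega>') \<in> bernstein_operator_equiv K N \<longleftrightarrow>
    \<Omega> \<in> bernstein_operators K N \<and> \<Omega>' \<in> bernstein_operators K N \<and>
    bernstein_iso K (semidirect_product K N \<Omega>) (semidirect_product K N \<Omega>') \<noteq> {}"
proof (cases "\<Omega> \<in> bernstein_operators K N \<and> \<Omega>' \<in> bernstein_operators K N")
  case False
  then show ?thesis by (auto simp: bernstein_operator_equiv_def)
next
  case True
  then have pair: "bernstein_pair K N \<Omega>" and pair': "bernstein_pair K N \<Omega>'"
    using assms by (auto simp: bernstein_pair_def bernstein_pair_axioms_def)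
  interpret P: bernstein_pair K N \<Omega> by fact
  interpret P': bernstein_pair K N \<Omega>' by fact
  show ?thesis
  proof (intro iffI conjI)
    assume "(\<Omega>, \<Omega>') \<in> bernstein_operator_equiv K N"
    then obtain v f where v: "v \<in> carrier N" and f: "f \<in> algebra_iso K N N"
      and conj: "\<And>x. x \<in> carrier N \<Longrightarrow>
        \<Omega>' x = f (\<Omega> (inv_into (carrier N) f x)) \<ominus>\<^bsub>N\<^esub> two K \<odot>\<^bsub>N\<^esub> (x \<otimes>\<^bsub>N\<^esub> v)"
      and fix_v: "\<Omega>' v = v \<ominus>\<^bsub>N\<^esub> (v \<otimes>\<^bsub>N\<^esub> v)"
      by (auto simp: bernstein_operator_equiv_def)
    note hom = algebra_homD[OF algebra_isoD(1)[OF f]]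
    have bij: "bij_betw f (carrier N) (carrier N)" using f by (rule algebra_isoD)
    have *: "f (\<Omega> x) = \<Omega>' (f x) \<oplus>\<^bsub>N\<^esub> (f x \<otimes>\<^bsub>N\<^esub> v \<oplus>\<^bsub>N\<^esub> f x \<otimes>\<^bsub>N\<^esub> v)" if x: "x \<in> carrier N" for x
    proof -
      have "inv_into (carrier N) f (f x) = x" using bij x by (simp add: bij_betw_def)
      then show ?thesis
        using conj[of "f x"] x v
        by (simp add: hom P.two_smult P.M.minus_eq P.M.a_assoc P.M.l_neg)
    qed
    have square_v: "v \<otimes>\<^bsub>N\<^esub> v \<oplus>\<^bsub>N\<^esub> \<Omega>' v = v"
      using v by (simp add: fix_v P.M.minus_eq P.M.a_comm[of v] P.M.r_neg2)
    have "(\<lambda>(x, \<alpha>). (f x, \<zero>\<^bsub>K\<^esub>) \<oplus>\<^bsub>fst P'.S\<^esub> \<alpha> \<odot>\<^bsub>fst P'.S\<^esub> (v, \<one>\<^bsub>K\<^esub>)) \<in> bernstein_iso K P.S (fst P'.S, snd P'.S)"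
    proof (rule P.semidirect_iso[OF P'.semidirect_bernstein])
      show "(v, \<one>\<^bsub>K\<^esub>) \<in> carrier (fst P'.S)" "snd P'.S (v, \<one>\<^bsub>K\<^esub>) = \<one>\<^bsub>K\<^esub>"
        using v by (simp_all add: P'.S_simps)
      show "(v, \<one>\<^bsub>K\<^esub>) \<otimes>\<^bsub>fst P'.S\<^esub> (v, \<one>\<^bsub>K\<^esub>) = (v, \<one>\<^bsub>K\<^esub>)"
        using v square_v by (simp add: P'.semidirect_square P.smult_one)
      show "(\<lambda>x. (f x, \<zero>\<^bsub>K\<^esub>)) \<in> algebra_hom K N (fst P'.S)"
        by (rule algebra_homI) (auto simp: hom P'.S_simps)
      show "bij_betw (\<lambda>x. (f x, \<zero>\<^bsub>K\<^esub>)) (carrier N) {a \<in> carrier (fst P'.S). snd P'.S a = \<zero>\<^bsub>K\<^esub>}"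
      proof -
        have "bij_betw (\<lambda>x. (x, \<zero>\<^bsub>K\<^esub>)) (carrier N) {a \<in> carrier (fst P'.S). snd P'.S a = \<zero>\<^bsub>K\<^esub>}"
          by (auto simp: bij_betw_def inj_on_def P'.S_simps)
        from bij_betw_trans[OF bij this] show ?thesis by (simp add: comp_def)
      qed
      fix x assume x: "x \<in> carrier N"
      have "(v, \<one>\<^bsub>K\<^esub>) \<otimes>\<^bsub>fst P'.S\<^esub> (f x, \<zero>\<^bsub>K\<^esub>) = (v \<otimes>\<^bsub>N\<^esub> f x \<oplus>\<^bsub>N\<^esub> P.half \<odot>\<^bsub>N\<^esub> \<Omega>' (f x), \<zero>\<^bsub>K\<^esub>)"
        using x v by (simp add: P'.S_simps hom)
      moreover have "P.half \<odot>\<^bsub>N\<^esub> y \<oplus>\<^bsub>N\<^esub> P.half \<odot>\<^bsub>N\<^esub> y = y" if "y \<in> carrier N" for y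
        using P.half_smult_double[of "\<one>\<^bsub>K\<^esub>" y] that by (simp add: P.smult_one)
      then have "(v \<otimes>\<^bsub>N\<^esub> f x \<oplus>\<^bsub>N\<^esub> v \<otimes>\<^bsub>N\<^esub> f x) \<oplus>\<^bsub>N\<^esub> (P.half \<odot>\<^bsub>N\<^esub> \<Omega>' (f x) \<oplus>\<^bsub>N\<^esub> P.half \<odot>\<^bsub>N\<^esub> \<Omega>' (f x)) = f (\<Omega> x)"
        using x v by (simp add: * hom P.M.a_comm P.mult_commutative[of v "f x"])
      ultimately show "(f (\<Omega> x), \<zero>\<^bsub>K\<^esub>) =
          (v, \<one>\<^bsub>K\<^esub>) \<otimes>\<^bsub>fst P'.S\<^esub> (f x, \<zero>\<^bsub>K\<^esub>) \<oplus>\<^bsub>fst P'.S\<^esub> (v, \<one>\<^bsub>K\<^esub>) \<otimes>\<^bsub>fst P'.S\<^esub> (f x, \<zero>\<^bsub>K\<^esub>)"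
        using x v by (simp add: P'.S_simps(2) hom P.M.a_ac)
    qed
    then show "bernstein_iso K P.S P'.S \<noteq> {}" by auto
  next
    assume "\<Omega> \<in> bernstein_operators K N \<and> \<Omega>' \<in> bernstein_operators K N \<and> bernstein_iso K P.S P'.S \<noteq> {}"
    then obtain \<psi> where "\<psi> \<in> bernstein_iso K P.S P'.S" by blast
    then obtain f v where f: "f \<in> algebra_iso K N N" and v: "v \<in> carrier N"
      and conj: "\<And>x. x \<in> carrier N \<Longrightarrow> \<Omega>' (f x) \<oplus>\<^bsub>N\<^esub> (f x \<otimes>\<^bsub>N\<^esub> v \<oplus>\<^bsub>N\<^esub> f x \<otimes>\<^bsub>N\<^esub> v) = f (\<Omega> x)"
      and fix_v: "\<Omega>' v \<oplus>\<^bsub>N\<^esub> v \<otimes>\<^bsub>N\<^esub> v = v"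
      using semidirect_iso_components[OF pair pair'] by blast
    have cancel: "y = z \<ominus>\<^bsub>N\<^esub> w" if "y \<oplus>\<^bsub>N\<^esub> w = z" "y \<in> carrier N" "w \<in> carrier N" for y z w
      using that by (auto simp: P.M.minus_eq P.M.a_assoc P.M.r_neg)
    have "\<Omega>' x = f (\<Omega> (inv_into (carrier N) f x)) \<ominus>\<^bsub>N\<^esub> two K \<odot>\<^bsub>N\<^esub> (x \<otimes>\<^bsub>N\<^esub> v)"
      if x: "x \<in> carrier N" for x
    proof -
      have "inv_into (carrier N) f x \<in> carrier N" "f (inv_into (carrier N) f x) = x"
        using algebra_isoD(2)[OF f] x by (auto simp: bij_betw_def f_inv_into_f inv_into_into)
      then show ?thesis
        using conj[of "inv_into (carrier N) f x"] x v by (intro cancel) (simp_all add: P.two_smult)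
    qed
    moreover have "\<Omega>' v = v \<ominus>\<^bsub>N\<^esub> (v \<otimes>\<^bsub>N\<^esub> v)" using fix_v v by (intro cancel) auto
    ultimately show "(\<Omega>, \<Omega>') \<in> bernstein_operator_equiv K N"
      using True f v by (auto simp: bernstein_operator_equiv_def)
  qed (use True in auto)
qed

section \<open>The classification\<close>

lemma semidirect_in_universe:
  fixes N :: "('k, 'u) module"
  assumes "bernstein_pair K N \<Omega>" "has_dimension K N c"
    and "infinite (carrier K)" "|carrier K| \<le>o |UNIV :: 'u set|"
  obtains B :: "('k, 'u) module \<times> ('u \<Rightarrow> 'k)" and g
  where "B \<in> bernstein_algebras K (cone +c c)" "g \<in> bernstein_iso K (semidirect_product K N \<Omega>) B"
proof -
  interpret P: bernstein_pair K N \<Omega> by fact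
  have "infinite (UNIV :: 'u set)" by (rule card_of_ordLeq_infinite[OF assms(4,3)])
  then have "|carrier N \<times> carrier K| \<le>o |UNIV :: 'u set|"
    using assms(4) card_of_mono1[of "carrier N" UNIV]
    by (intro card_of_Sigma_ordLeq_infinite) auto
  then have "|carrier (fst P.S)| \<le>o |UNIV :: 'u set|" by (simp add: P.S_simps)
  from bernstein_algebra_in_universe[OF P.semidirect_bernstein this P.semidirect_dimension[OF assms(2)]]
  obtain B :: "('k, 'u) module" and \<omega> g where B: "(B, \<omega>) \<in> bernstein_algebras K (cone +c c)"
    and g: "g \<in> bernstein_iso K (fst P.S, snd P.S) (B, \<omega>)" .
  from g have "g \<in> bernstein_iso K P.S (B, \<omega>)" by (simp only: prod.collapse)
  with B show thesis by (rule that)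
qed

text \<open>Equal types imply isomorphic algebras only because the types are non-empty: both contain the copy
  of the first semidirect product in the universe.\<close>

lemma semidirect_type_eq_iff:
  fixes N N' :: "('k, 'u) module"
  assumes P: "bernstein_pair K N \<Omega>" "has_dimension K N c" and P': "bernstein_pair K N' \<Omega>'"
    and K: "infinite (carrier K)" "|carrier K| \<le>o |UNIV :: 'u set|"
  shows "(bernstein_type K (cone +c c) (semidirect_product K N \<Omega>) :: (('k, 'u) module \<times> ('u \<Rightarrow> 'k)) set) =
      bernstein_type K (cone +c c) (semidirect_product K N' \<Omega>') \<longleftrightarrow>
    bernstein_iso K (semidirect_product K N \<Omega>) (semidirect_product K N' \<Omega>') \<noteq> {}"
    (is "?t = ?t' \<longleftrightarrow> _")
proof
  interpret P: bernstein_pair K N \<Omega> by fact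
  interpret P': bernstein_pair K N' \<Omega>' by fact
  have S: "nonassoc_algebra K (fst P.S)" "nonassoc_algebra K (fst P'.S)"
    using P.semidirect_algebra P'.semidirect_algebra by (auto simp: comm_nonassoc_algebra_def)
  show "?t = ?t'" if "bernstein_iso K P.S P'.S \<noteq> {}"
    using that bernstein_type_eqI[OF S(1)] by blast
  assume eq: "?t = ?t'"
  obtain B :: "('k, 'u) module \<times> ('u \<Rightarrow> 'k)" and g
    where B: "B \<in> bernstein_algebras K (cone +c c)" and g: "g \<in> bernstein_iso K P.S B"
    using semidirect_in_universe[OF P K] by blast
  then have "B \<in> ?t'" using eq by (auto simp: bernstein_type_def)
  then obtain g' where g': "g' \<in> bernstein_iso K P'.S B" by (auto simp: bernstein_type_def)
  have "inv_into (carrier (fst P'.S)) g' \<in> bernstein_iso K B P'.S"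
    using S(2) g' by (rule bernstein_iso_inv)
  then show "bernstein_iso K P.S P'.S \<noteq> {}" using bernstein_iso_comp[OF g] by blast
qed

lemma semidirect_type_mem:
  fixes N :: "('k, 'u) module"
  assumes P: "bernstein_pair K N \<Omega>" "has_dimension K N c"
    and K: "infinite (carrier K)" "|carrier K| \<le>o |UNIV :: 'u set|"
  shows "bernstein_type K (cone +c c) (semidirect_product K N \<Omega>)
    \<in> (bernstein_types K (cone +c c) :: (('k, 'u) module \<times> ('u \<Rightarrow> 'k)) set set)"
proof -
  interpret P: bernstein_pair K N \<Omega> by fact
  obtain B :: "('k, 'u) module \<times> ('u \<Rightarrow> 'k)" and g
    where B: "B \<in> bernstein_algebras K (cone +c c)" and g: "g \<in> bernstein_iso K P.S B"
    using semidirect_in_universe[OF P K] by blast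
  have "nonassoc_algebra K (fst P.S)"
    using P.semidirect_algebra by (simp add: comm_nonassoc_algebra_def)
  from bernstein_type_eqI[OF this g] show ?thesis using B by (auto simp: bernstein_types_def)
qed

text \<open>A type is recovered from any of its members, in particular from the chosen representative.\<close>

lemma four_algebra_types_member:
  fixes T :: "('k, 'u) module set"
  assumes "T \<in> four_algebra_types K c" "N \<in> T"
  shows "four_algebra K N" "has_dimension K N c" "four_algebra_type K c N = T"
proof -
  obtain M :: "('k, 'u) module" and f
    where M: "M \<in> four_algebras K c" "T = four_algebra_type K c M"
      and N: "N \<in> four_algebras K c" and f: "f \<in> algebra_iso K M N"
    using assms by (auto simp: four_algebra_types_def four_algebra_type_def)
  show "four_algebra K N" "has_dimension K N c" using N by (auto simp: four_algebras_def)
  have "nonassoc_algebra K M"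
    using M by (auto simp: four_algebras_def four_algebra_def comm_nonassoc_algebra_def)
  then have "(four_algebra_type K c M :: ('k, 'u) module set) = four_algebra_type K c N"
    using f by (rule four_algebra_type_eqI)
  then show "four_algebra_type K c N = T" using M by simp
qed

text \<open>The kernel of the weight may be replaced by any 4-algebra of its type, in particular by the
  chosen representative.\<close>

lemma bernstein_algebra_is_semidirect:
  fixes A :: "('k, 'u) module" and c :: "'c rel"
  assumes A: "bernstein_algebra K A \<omega>" and dim: "has_dimension K A (cone +c c)" and c: "Card_order c"
    and K: "infinite (carrier K)" "two K \<noteq> \<zero>\<^bsub>K\<^esub>"
  obtains T :: "('k, 'u) module set" where "T \<in> four_algebra_types K c"
    and "\<And>N. N \<in> T \<Longrightarrow> \<exists>\<Omega>\<in>bernstein_operators K N. bernstein_iso K (semidirect_product K N \<Omega>) (A, \<omega>) \<noteq> {}"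
proof
  interpret bernstein_algebra K A \<omega> by fact
  let ?N = "A\<lparr>carrier := weight_kernel\<rparr>"
  have "\<omega> \<in> module_hom K A (scalar_algebra K)" using weight_hom by (simp add: algebra_hom_def)
  then have "has_dimension K ?N c"
    using weight_nonzero has_dimension_hyperplane[OF vectorspace_axioms _ _ _ c dim] by blast
  then have N0: "?N \<in> four_algebras K c" using kernel_four_algebra by (simp add: four_algebras_def)
  then show "(four_algebra_type K c ?N :: ('k, 'u) module set) \<in> four_algebra_types K c"
    unfolding four_algebra_types_def by (rule imageI)
  obtain e where e: "e \<in> carrier A" "\<omega> e = \<one>\<^bsub>K\<^esub>" "e \<otimes>\<^bsub>A\<^esub> e = e" by (rule idempotent_exists)
  fix N :: "('k, 'u) module" assume "N \<in> four_algebra_type K c ?N"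
  then obtain h where N: "four_algebra K N" and h: "h \<in> algebra_iso K ?N N"
    by (auto simp: four_algebra_type_def four_algebras_def)
  have "nonassoc_algebra K ?N"
    using N0 by (simp add: four_algebras_def four_algebra_def comm_nonassoc_algebra_def)
  then obtain f where f: "f \<in> algebra_iso K N ?N" using algebra_iso_inv[OF _ h] by blast
  have hom: "f \<in> algebra_hom K N A"
    using algebra_homD[OF algebra_isoD(1)[OF f]] by (auto intro: algebra_homI)
  have bij: "bij_betw f (carrier N) weight_kernel" using algebra_isoD(2)[OF f] by simp
  obtain \<Omega> where \<Omega>: "\<Omega> \<in> bernstein_operators K N"
    and peirce: "\<And>x. x \<in> carrier N \<Longrightarrow> f (\<Omega> x) = e \<otimes>\<^bsub>A\<^esub> f x \<oplus>\<^bsub>A\<^esub> e \<otimes>\<^bsub>A\<^esub> f x"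
    using peirce_operator[OF K e N hom bij] by blast
  interpret P: bernstein_pair K N \<Omega>
    using N \<Omega> K by (simp add: bernstein_pair_def bernstein_pair_axioms_def)
  show "\<exists>\<Omega>\<in>bernstein_operators K N. bernstein_iso K (semidirect_product K N \<Omega>) (A, \<omega>) \<noteq> {}"
    using P.semidirect_iso[OF A e hom bij peirce] by (intro bexI[OF _ \<Omega>]) (rule ex_in_conv[THEN iffD1], rule exI)
qed

theorem theorem2p11:
  fixes K :: "('k, 'm) ring_scheme"
    and c :: "'c rel"
    and rep :: "('k, 'u) module set \<Rightarrow> ('k, 'u) module"
  assumes "field K"
    and "infinite (carrier K)"
    and "two K \<noteq> \<zero>\<^bsub>K\<^esub>"
    and "Card_order c"
    and universe: "|carrier K| \<le>o |UNIV :: 'u set|"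
    and representatives: "\<And>T. T \<in> four_algebra_types K c \<Longrightarrow> rep T \<in> T"
  shows "(\<forall>T\<in>four_algebra_types K c. \<forall>\<Omega>\<in>bernstein_operators K (rep T).
            xi K c rep (T, bernstein_operator_equiv K (rep T) `` {\<Omega>}) =
              bernstein_type K (cone +c c) (semidirect_product K (rep T) \<Omega>))
       \<and> bij_betw (xi K c rep) (operator_class_coproduct K c rep) (bernstein_types K (cone +c c))"
proof
  let ?S = "\<lambda>T. semidirect_product K (rep T)"
  let ?R = "\<lambda>T. bernstein_operator_equiv K (rep T)"
  let ?btype = "bernstein_type K (cone +c c) ::
    ('k, 'u \<times> 'k) module \<times> ('u \<times> 'k \<Rightarrow> 'k) \<Rightarrow> (('k, 'u) module \<times> ('u \<Rightarrow> 'k)) set"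
  note rep = four_algebra_types_member[OF _ representatives]
  have pair: "bernstein_pair K (rep T) \<Omega>"
    if "T \<in> four_algebra_types K c" "\<Omega> \<in> bernstein_operators K (rep T)" for T \<Omega>
    using that rep assms(3) by (simp add: bernstein_pair_def bernstein_pair_axioms_def)
  have type_eq: "?btype (?S T \<Omega>) = ?btype (?S T' \<Omega>') \<longleftrightarrow> bernstein_iso K (?S T \<Omega>) (?S T' \<Omega>') \<noteq> {}"
    if "T \<in> four_algebra_types K c" "\<Omega> \<in> bernstein_operators K (rep T)"
      "T' \<in> four_algebra_types K c" "\<Omega>' \<in> bernstein_operators K (rep T')" for T \<Omega> T' \<Omega>'
    using that assms(2) universe by (intro semidirect_type_eq_iff pair rep)
  \<comment> \<open>In this form the relation is visibly an equivalence.\<close>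
  have equiv: "(\<Omega>, \<Omega>') \<in> ?R T \<longleftrightarrow> \<Omega> \<in> bernstein_operators K (rep T) \<and>
      \<Omega>' \<in> bernstein_operators K (rep T) \<and> ?btype (?S T \<Omega>) = ?btype (?S T \<Omega>')"
    if "T \<in> four_algebra_types K c" for T \<Omega> \<Omega>'
    using that by (simp add: bernstein_operator_equiv_iff[OF rep(1) assms(3)] type_eq cong: conj_cong)
  show xi: "\<forall>T\<in>four_algebra_types K c. \<forall>\<Omega>\<in>bernstein_operators K (rep T).
      xi K c rep (T, ?R T `` {\<Omega>}) = ?btype (?S T \<Omega>)"
  proof (intro ballI)
    fix T \<Omega> assume T: "T \<in> four_algebra_types K c" and \<Omega>: "\<Omega> \<in> bernstein_operators K (rep T)"
    have "?R T `` {\<Omega>} \<noteq> {}" and "\<And>\<Omega>'. \<Omega>' \<in> ?R T `` {\<Omega>} \<Longrightarrow> ?btype (?S T \<Omega>') = ?btype (?S T \<Omega>)"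
      using \<Omega> by (auto simp: equiv[OF T])
    then show "xi K c rep (T, ?R T `` {\<Omega>}) = ?btype (?S T \<Omega>)" by (auto simp: xi_def)
  qed
  have in_coproduct: "p \<in> operator_class_coproduct K c rep \<longleftrightarrow> (\<exists>T \<Omega>. T \<in> four_algebra_types K c \<and>
      \<Omega> \<in> bernstein_operators K (rep T) \<and> p = (T, ?R T `` {\<Omega>}))" for p
    by (auto simp: operator_class_coproduct_def quotient_def)
  show "bij_betw (xi K c rep) (operator_class_coproduct K c rep) (bernstein_types K (cone +c c))"
    unfolding bij_betw_def
  proof
    show "inj_on (xi K c rep) (operator_class_coproduct K c rep)"
    proof (rule inj_onI)
      fix p p' assume "p \<in> operator_class_coproduct K c rep" "p' \<in> operator_class_coproduct K c rep"
        and eq: "xi K c rep p = xi K c rep p'"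
      then obtain T \<Omega> T' \<Omega>'
        where T: "T \<in> four_algebra_types K c" "\<Omega> \<in> bernstein_operators K (rep T)" "p = (T, ?R T `` {\<Omega>})"
          and T': "T' \<in> four_algebra_types K c" "\<Omega>' \<in> bernstein_operators K (rep T')" "p' = (T', ?R T' `` {\<Omega>'})"
        unfolding in_coproduct by blast
      have same: "?btype (?S T \<Omega>) = ?btype (?S T' \<Omega>')" using xi T T' eq by auto
      then obtain \<psi> where "\<psi> \<in> bernstein_iso K (?S T \<Omega>) (?S T' \<Omega>')" using type_eq T T' by blast
      then obtain f where f: "f \<in> algebra_iso K (rep T) (rep T')"
        using semidirect_iso_components[OF pair[OF T(1,2)] pair[OF T'(1,2)]] by blast
      have "nonassoc_algebra K (rep T)"
        using rep(1)[OF T(1) T(1)] by (simp add: four_algebra_def comm_nonassoc_algebra_def)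
      from four_algebra_type_eqI[OF this f, of c] have "T = T'"
        using rep(3) T T' by metis
      then show "p = p'" using T T' same by (auto simp: equiv[OF T'(1)])
    qed
    show "xi K c rep ` operator_class_coproduct K c rep = bernstein_types K (cone +c c)"
    proof
      show "xi K c rep ` operator_class_coproduct K c rep \<subseteq> bernstein_types K (cone +c c)"
      proof
        fix t assume "t \<in> xi K c rep ` operator_class_coproduct K c rep"
        then obtain T \<Omega> where T: "T \<in> four_algebra_types K c" "\<Omega> \<in> bernstein_operators K (rep T)"
          and "t = ?btype (?S T \<Omega>)"
          using xi by (auto simp: in_coproduct)
        then show "t \<in> bernstein_types K (cone +c c)"
          using semidirect_type_mem[OF pair[OF T] rep(2)[OF T(1) T(1)] assms(2) universe] by simp
      qed
      show "bernstein_types K (cone +c c) \<subseteq> xi K c rep ` operator_class_coproduct K c rep"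
      proof
        fix t :: "(('k, 'u) module \<times> ('u \<Rightarrow> 'k)) set" assume "t \<in> bernstein_types K (cone +c c)"
        then obtain A :: "('k, 'u) module" and \<omega> where A: "bernstein_algebra K A \<omega>" "has_dimension K A (cone +c c)"
          and t: "t = bernstein_type K (cone +c c) (A, \<omega>)"
          by (auto simp: bernstein_types_def bernstein_algebras_def)
        obtain T :: "('k, 'u) module set" where T: "T \<in> four_algebra_types K c"
          and "\<And>N. N \<in> T \<Longrightarrow> \<exists>\<Omega>\<in>bernstein_operators K N. bernstein_iso K (semidirect_product K N \<Omega>) (A, \<omega>) \<noteq> {}"
          by (rule bernstein_algebra_is_semidirect[OF A assms(4,2,3)]) blast
        then obtain \<Omega> \<psi> where \<Omega>: "\<Omega> \<in> bernstein_operators K (rep T)"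
          and psi: "\<psi> \<in> bernstein_iso K (?S T \<Omega>) (A, \<omega>)"
          using representatives by blast
        interpret P: bernstein_pair K "rep T" \<Omega> using T \<Omega> by (rule pair)
        have "nonassoc_algebra K (fst P.S)"
          using P.semidirect_algebra by (simp add: comm_nonassoc_algebra_def)
        from bernstein_type_eqI[OF this psi] have "t = xi K c rep (T, ?R T `` {\<Omega>})"
          using xi T \<Omega> t by auto
        then show "t \<in> xi K c rep ` operator_class_coproduct K c rep"
          using T \<Omega> in_coproduct by blast
      qed
    qed
  qed
qed

end
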